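(* (i) For every real $q$ with $0<q<1$, $$\frac{(q;q)_\infty^2\,(q^{5/6};q)_\infty^2}{(q^{1/2};q)_\infty(q^{3/2};q)_\infty(q^{1/3};q)_\infty(q^{4/3};q)_\infty} =\sum_{n=0}^{\infty}(-1)^n\frac{(q^{1/2},q^{5/3};q)_n\,(q^{1/2},q^{1/2},q^{1/3};q^{1/2})_n}{(q^{1/3},q^{4/3};q)_n\,(q^{3/2};q^{1/2})_{3n}}\,q^{\frac{n(9n+7)}{12}}$$ $$\times\frac{1-q^{2/3}}{1-q}\left\{q^{n+\frac12}\,\frac{1+q^{1/6}}{1+q^{\frac n2+\frac13}}+\frac{1-q^{\frac52n+\frac76}}{1-q^{n+\frac13}}\right\}.$$ (ii) The limiting case $q\to1$ gives $$\frac{\pi\,\Gamma(\frac13)^2}{6\,\Gamma(\frac56)^2}=\sum_{n=0}^{\infty}\left(\frac{-1}{27}\right)^n\frac{(1)_n(\frac12)_n(\frac23)_n}{(\frac43)_n^3}\,(3+7n).$$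
   Context: For a base $p$: $(x;p)_0=1$, $(x;p)_n=\prod_{j=0}^{n-1}(1-p^jx)$, $(x;p)_\infty=\prod_{j\ge0}(1-p^jx)$, and $(x_1,\dots,x_r;p)_n=(x_1;p)_n\cdots(x_r;p)_n$. Fractional powers of $q$ are the positive real ones. $(x)_0=1$ and $(x)_n=x(x+1)\cdots(x+n-1)$ is the ordinary shifted factorial. *)

theory Defs
  imports "HOL-Analysis.Analysis"
begin

definition qpoch :: "real \<Rightarrow> real \<Rightarrow> nat \<Rightarrow> real" where
  "qpoch x p n = (\<Prod>j<n. 1 - p ^ j * x)"

definition qpochs :: "real list \<Rightarrow> real \<Rightarrow> nat \<Rightarrow> real" where
  "qpochs xs p n = (\<Prod>x\<leftarrow>xs. qpoch x p n)"

definition qpoch_inf :: "real \<Rightarrow> real \<Rightarrow> real" where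
  "qpoch_inf x p = (\<Prod>j. 1 - p ^ j * x)"

text \<open>The infinite product is a genuine one for every base used here, not a default value.\<close>

lemma convergent_prod_qpoch_inf:
  fixes p x :: real
  assumes "\<bar>p\<bar> < 1"
  shows "convergent_prod (\<lambda>j. 1 - p ^ j * x)"
proof -
  have "summable (\<lambda>j. \<bar>p\<bar> ^ j * \<bar>x\<bar>)"
    using assms by (intro summable_mult2 summable_geometric) simp
  then have "summable (\<lambda>j. norm ((1 - p ^ j * x) - 1))"
    by (simp add: abs_mult power_abs)
  then show ?thesis
    by (intro abs_convergent_prod_imp_convergent_prod summable_imp_abs_convergent_prod)
qed

definition q_product :: "real \<Rightarrow> real" where
  "q_product q =
     (qpoch_inf q q)\<^sup>2 * (qpoch_inf (q powr (5/6)) q)\<^sup>2 /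
     (qpoch_inf (q powr (1/2)) q * qpoch_inf (q powr (3/2)) q *
      qpoch_inf (q powr (1/3)) q * qpoch_inf (q powr (4/3)) q)"

definition q_summand :: "real \<Rightarrow> nat \<Rightarrow> real" where
  "q_summand q n =
     (-1) ^ n *
     (qpochs [q powr (1/2), q powr (5/3)] q n *
      qpochs [q powr (1/2), q powr (1/2), q powr (1/3)] (q powr (1/2)) n) /
     (qpochs [q powr (1/3), q powr (4/3)] q n *
      qpoch (q powr (3/2)) (q powr (1/2)) (3 * n)) *
     q powr (real n * (9 * real n + 7) / 12) *
     ((1 - q powr (2/3)) / (1 - q)) *
     (q powr (real n + 1/2) *
        ((1 + q powr (1/6)) / (1 + q powr (real n / 2 + 1/3))) +
      (1 - q powr (5/2 * real n + 7/6)) / (1 - q powr (real n + 1/3)))"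

definition limit_product :: real where
  "limit_product = pi * (Gamma (1/3))\<^sup>2 / (6 * (Gamma (5/6))\<^sup>2)"

definition limit_summand :: "nat \<Rightarrow> real" where
  "limit_summand n =
     (- 1 / 27) ^ n *
     (pochhammer 1 n * pochhammer (1/2) n * pochhammer (2/3) n / (pochhammer (4/3) n) ^ 3) *
     (3 + 7 * real n)"

end

theory Submission
  imports Defs
begin

text \<open>Put \<open>p = q\<^sup>1\<^sup>/\<^sup>2\<close>. The quadratic series
  \<open>\<Sum>\<^sub>k (1 - a p\<^sup>3\<^sup>k) (a;p\<^sup>2)\<^sub>k (b,c,e;p)\<^sub>k p^(k(k+1)/2) / ((p;p)\<^sub>k (bcp,bep,cep;p\<^sup>2)\<^sub>k)\<close>
  with \<open>a p = b c e\<close> equals \<open>(bp,cp,ep,a;p\<^sup>2)\<^sub>\<infinity> / (p,bcp,bep,cep;p\<^sup>2)\<^sub>\<infinity>\<close>: both sides satisfy the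
  same first-order recurrence under \<open>b \<mapsto> p\<^sup>2 b\<close> (and likewise for \<open>c\<close>, \<open>e\<close>), which reduces
  everything to \<open>b = c = e = 0\<close>. The series is the row \<open>n = 0\<close> of a Wilf--Zeilberger pair
  \<open>F(n+1,k) - F(n,k) = G(n,k+1) - G(n,k)\<close> whose row sums \<open>\<Sum>\<^sub>k F(n,k)\<close> tend to \<open>0\<close>, so it also equals
  \<open>\<Sum>\<^sub>n G(n,0)\<close>. For \<open>b = c = p\<close>, \<open>e = q\<^sup>1\<^sup>/\<^sup>3\<close> this is \<open>1 - q\<^sup>1\<^sup>/\<^sup>3\<close> times the identity (i).
  The limit \<open>q \<rightarrow> 1\<close> is dominated on both sides: the summands are at most \<open>6 (5/9)\<^sup>n\<close> for every \<open>q\<close>,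
  and the logarithm of the \<open>j\<close>-th factor of the product is \<open>O(1/j\<^sup>2)\<close> uniformly in \<open>q\<close>.\<close>

section \<open>Finite and infinite shifted factorials\<close>

lemma qpoch_0 [simp]: "qpoch x p 0 = 1"
  by (simp add: qpoch_def)

lemma qpoch_zero [simp]: "qpoch 0 p n = 1" "qpoch_inf 0 p = 1"
  by (simp_all add: qpoch_def qpoch_inf_def)

lemma qpoch_Suc [simp]: "qpoch x p (Suc n) = qpoch x p n * (1 - p ^ n * x)"
  by (simp add: qpoch_def)

lemma qpoch_shift: "(1 - x) * qpoch (p * x) p n = qpoch x p n * (1 - p ^ n * x)"
proof (induction n)
  case (Suc n)
  have "(1 - x) * qpoch (p * x) p (Suc n) = ((1 - x) * qpoch (p * x) p n) * (1 - p ^ Suc n * x)"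
    by (simp add: mult_ac)
  also have "\<dots> = qpoch x p (Suc n) * (1 - p ^ Suc n * x)"
    by (simp add: Suc)
  finally show ?case .
qed simp

lemma qpoch_add: "qpoch x p (m + n) = qpoch x p m * qpoch (p ^ m * x) p n"
  by (induction n) (auto simp: power_add mult_ac)

lemma qpoch_nonneg:
  assumes "0 \<le> p" "p \<le> 1" "0 \<le> x" "x \<le> 1"
  shows "0 \<le> qpoch x p n"
  unfolding qpoch_def using assms by (intro prod_nonneg) (simp add: mult_le_one power_le_one)

lemma power_mult_less_one:
  fixes p x :: real
  assumes "0 < p" "p \<le> 1" "x < 1"
  shows "p ^ j * x < 1"
proof (cases "0 \<le> x")
  case True
  then have "p ^ j * x \<le> 1 * x"
    using assms by (intro mult_right_mono power_le_one) auto
  then show ?thesis using assms by simp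
next
  case False
  then have "p ^ j * x \<le> 0"
    using assms by (intro mult_nonneg_nonpos) auto
  then show ?thesis by simp
qed

lemma qpoch_pos:
  assumes "0 < p" "p \<le> 1" "x < 1"
  shows "0 < qpoch x p n"
  unfolding qpoch_def using power_mult_less_one[OF assms] by (intro prod_pos) auto

lemma qpoch_le_1:
  assumes "0 \<le> p" "p \<le> 1" "0 \<le> x" "x \<le> 1"
  shows "qpoch x p n \<le> 1"
proof -
  have "p ^ j * x \<le> 1" for j
    using assms by (simp add: mult_le_one power_le_one)
  then show ?thesis
    unfolding qpoch_def using assms by (intro prod_le_1) auto
qed

lemma qpoch_LIMSEQ:
  assumes "\<bar>p\<bar> < 1"
  shows "qpoch x p \<longlonglongrightarrow> qpoch_inf x p"
proof -
  have "(\<lambda>n. \<Prod>j\<le>n. 1 - p ^ j * x) \<longlonglongrightarrow> qpoch_inf x p"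
    unfolding qpoch_inf_def by (intro convergent_prod_LIMSEQ convergent_prod_qpoch_inf assms)
  then show ?thesis
    unfolding qpoch_def LIMSEQ_lessThan_iff_atMost .
qed

text \<open>A convergent product in the sense of \<open>convergent_prod\<close> can vanish only
  through a vanishing factor, and every \<open>p ^ j * x\<close> is below 1.\<close>

lemma qpoch_inf_nonzero:
  assumes "0 < p" "p < 1" "x < 1"
  shows "qpoch_inf x p \<noteq> 0"
proof
  assume *: "qpoch_inf x p = 0"
  have cp: "convergent_prod (\<lambda>j. 1 - p ^ j * x)"
    using assms by (intro convergent_prod_qpoch_inf) auto
  have "(\<lambda>j. 1 - p ^ j * x) has_prod 0"
    using convergent_prod_has_prod[OF cp] * by (simp add: qpoch_inf_def)
  then obtain j where "p ^ j * x = 1"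
    by (auto simp: has_prod_0_iff)
  with power_mult_less_one[of p x j] assms show False by auto
qed

lemma qpoch_inf_pos:
  assumes "0 < p" "p < 1" "x < 1"
  shows "0 < qpoch_inf x p"
proof -
  have "0 \<le> qpoch_inf x p"
    using assms by (intro LIMSEQ_le_const[OF qpoch_LIMSEQ]) (auto intro!: exI less_imp_le qpoch_pos)
  with qpoch_inf_nonzero[OF assms] show ?thesis by simp
qed

lemma qpoch_inf_le_qpoch:
  assumes "0 < p" "p < 1" "0 \<le> x" "x \<le> 1"
  shows "qpoch_inf x p \<le> qpoch x p n"
proof -
  have le: "p ^ j * x \<le> 1" for j
    using assms by (simp add: mult_le_one power_le_one)
  have "decseq (qpoch x p)"
    unfolding decseq_Suc_iff using assms le
    by (auto intro!: mult_left_le qpoch_nonneg)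
  then show ?thesis
    by (rule decseq_ge) (use assms in \<open>auto intro: qpoch_LIMSEQ\<close>)
qed

lemma qpoch_inf_shift:
  assumes "\<bar>p\<bar> < 1"
  shows "(1 - x) * qpoch_inf (p * x) p = qpoch_inf x p"
proof -
  have "(\<lambda>n. (1 - x) * qpoch (p * x) p n) \<longlonglongrightarrow> (1 - x) * qpoch_inf (p * x) p"
    by (intro tendsto_intros qpoch_LIMSEQ assms)
  moreover have "(\<lambda>n. qpoch x p n * (1 - p ^ n * x)) \<longlonglongrightarrow> qpoch_inf x p * (1 - 0 * x)"
    by (intro tendsto_intros qpoch_LIMSEQ assms LIMSEQ_power_zero) (use assms in auto)
  ultimately show ?thesis
    using LIMSEQ_unique by (fastforce simp: qpoch_shift)
qed

text \<open>Supplies a lower bound for the denominators of \<open>kern\<close> that depends neither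
  on the parameters nor on the index: the comparison is factor by factor, since p^(2j) x is at most
  p^j p.\<close>

lemma qpoch_square_base_ge:
  assumes "0 < p" "p < 1" "0 \<le> x" "x \<le> p"
  shows "qpoch_inf p p \<le> qpoch x (p\<^sup>2) n"
proof -
  have "qpoch_inf p p \<le> qpoch p p n"
    using assms by (intro qpoch_inf_le_qpoch) auto
  also have "\<dots> \<le> qpoch x (p\<^sup>2) n"
    unfolding qpoch_def
  proof (intro prod_mono conjI)
    fix j
    show "0 \<le> 1 - p ^ j * p"
      using assms by (simp add: mult_le_one power_le_one)
    have "(p\<^sup>2) ^ j * x \<le> p ^ j * p"
      unfolding power_mult[symmetric] using assms by (intro mult_mono power_decreasing) auto
    then show "1 - p ^ j * p \<le> 1 - (p\<^sup>2) ^ j * x" by simp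
  qed
  finally show ?thesis .
qed

section \<open>A Wilf--Zeilberger pair\<close>

text \<open>The free parameters \<open>b\<close>, \<open>c\<close>, \<open>e\<close> enter symmetrically; the base parameter of the
  quadratic series is \<open>a = b c e / p\<close>. In the factors \<open>b - p\<^sup>2 p\<^sup>2\<^sup>j\<close> the usual
  \<open>(p\<^sup>2/b; p\<^sup>2)\<^sub>n\<close> is multiplied by \<open>b\<^sup>n\<close>, so that \<open>b = 0\<close> is admitted.\<close>

definition kern :: "real \<Rightarrow> real \<Rightarrow> real \<Rightarrow> real \<Rightarrow> nat \<Rightarrow> nat \<Rightarrow> real" where
  "kern p b c e n k =
     (-1) ^ n * p ^ (3 * (\<Sum>i<n. i)) *
     (\<Prod>j<n. (b - p\<^sup>2 * (p ^ j)\<^sup>2) * (c - p\<^sup>2 * (p ^ j)\<^sup>2) * (e - p\<^sup>2 * (p ^ j)\<^sup>2)) *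
     qpoch (b * c * e / p) (p\<^sup>2) k * p ^ (3 * n * k + (\<Sum>i\<le>k. i)) *
     (qpoch b p (n + k) * qpoch c p (n + k) * qpoch e p (n + k)) /
     (qpoch (b * c * p) (p\<^sup>2) (n + k) * qpoch (b * e * p) (p\<^sup>2) (n + k) *
      qpoch (c * e * p) (p\<^sup>2) (n + k))"

definition WZ_F :: "real \<Rightarrow> real \<Rightarrow> real \<Rightarrow> real \<Rightarrow> nat \<Rightarrow> nat \<Rightarrow> real" where
  "WZ_F p b c e n k =
     (1 - b * c * e / p * p ^ (3 * (n + k))) * kern p b c e n k / qpoch p p (3 * n + k)"

text \<open>The polynomial in the Wilf--Zeilberger mate of \<^const>\<open>WZ_F\<close>, with \<open>N = p\<^sup>n\<close> and
  \<open>X = p\<^sup>k\<close>; it solves the Gosper equation \<open>WZ_certificate\<close>.\<close>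

definition WZ_H :: "real \<Rightarrow> real \<Rightarrow> real \<Rightarrow> real \<Rightarrow> real \<Rightarrow> real \<Rightarrow> real" where
  "WZ_H p b c e N X =
     (1 - p\<^sup>2 * (N ^ 3 * X) + p ^ 3 * (N ^ 3 * X)\<^sup>2)
     - b * c * e / p * (N * X) ^ 3 * (1 - p * (N ^ 3 * X) + p ^ 3 * (N ^ 3 * X)\<^sup>2)
     - p * N\<^sup>2 * (N * X)\<^sup>2 * ((b + c + e) - (b * c + b * e + c * e) * (N * X))"

text \<open>With the index 3n + k + 2, the number (p;p)_(3n+k+3) is a common multiple of the shifted
  factorials of base p that divide the four terms of the pair equation.\<close>

definition WZ_G :: "real \<Rightarrow> real \<Rightarrow> real \<Rightarrow> real \<Rightarrow> nat \<Rightarrow> nat \<Rightarrow> real" where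
  "WZ_G p b c e n k = WZ_H p b c e (p ^ n) (p ^ k) * kern p b c e n k / qpoch p p (3 * n + k + 2)"

text \<open>The ratio of neighbouring values is rational in p^n and p^k. Its denominator is kept on
  the left so that the pair equation reduces to a polynomial identity.\<close>

lemma kern_Suc_left:
  assumes "1 - b * c * p * (p ^ (n + k))\<^sup>2 \<noteq> 0"
    "1 - b * e * p * (p ^ (n + k))\<^sup>2 \<noteq> 0" "1 - c * e * p * (p ^ (n + k))\<^sup>2 \<noteq> 0"
  shows "kern p b c e (Suc n) k * ((1 - b * c * p * (p ^ (n + k))\<^sup>2) *
      (1 - b * e * p * (p ^ (n + k))\<^sup>2) * (1 - c * e * p * (p ^ (n + k))\<^sup>2)) =
    - kern p b c e n k * (p ^ n) ^ 3 * (p ^ k) ^ 3 *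
      ((b - p\<^sup>2 * (p ^ n)\<^sup>2) * (c - p\<^sup>2 * (p ^ n)\<^sup>2) * (e - p\<^sup>2 * (p ^ n)\<^sup>2)) *
      ((1 - b * p ^ (n + k)) * (1 - c * p ^ (n + k)) * (1 - e * p ^ (n + k)))"
proof -
  have D: "(p\<^sup>2) ^ (n + k) = (p ^ (n + k))\<^sup>2"
    by (simp add: power_mult[symmetric] mult.commute)
  have E: "p ^ (3 * (\<Sum>i<Suc n. i)) = p ^ (3 * (\<Sum>i<n. i)) * (p ^ n) ^ 3"
    "p ^ (3 * Suc n * k + (\<Sum>i\<le>k. i)) = p ^ (3 * n * k + (\<Sum>i\<le>k. i)) * (p ^ k) ^ 3"
    by (simp_all add: power_add power_mult power_commutes algebra_simps power2_eq_square
        power3_eq_cube power_mult_distrib)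
  show ?thesis
    unfolding kern_def E add_Suc qpoch_Suc prod.lessThan_Suc power_Suc[of "-1"] D
    using assms by (simp add: divide_simps mult_ac)
qed

lemma kern_Suc_right:
  assumes "1 - b * c * p * (p ^ (n + k))\<^sup>2 \<noteq> 0"
    "1 - b * e * p * (p ^ (n + k))\<^sup>2 \<noteq> 0" "1 - c * e * p * (p ^ (n + k))\<^sup>2 \<noteq> 0"
  shows "kern p b c e n (Suc k) * ((1 - b * c * p * (p ^ (n + k))\<^sup>2) *
      (1 - b * e * p * (p ^ (n + k))\<^sup>2) * (1 - c * e * p * (p ^ (n + k))\<^sup>2)) =
    kern p b c e n k * (1 - b * c * e / p * (p ^ k)\<^sup>2) * ((p ^ n) ^ 3 * (p * p ^ k)) *
      ((1 - b * p ^ (n + k)) * (1 - c * p ^ (n + k)) * (1 - e * p ^ (n + k)))"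
proof -
  have D: "(p\<^sup>2) ^ m = (p ^ m)\<^sup>2" for m
    by (simp add: power_mult[symmetric] mult.commute)
  have E: "p ^ (3 * n * Suc k + (\<Sum>i\<le>Suc k. i)) =
      p ^ (3 * n * k + (\<Sum>i\<le>k. i)) * ((p ^ n) ^ 3 * (p * p ^ k))"
    by (simp add: power_add power_mult algebra_simps power3_eq_cube power_mult_distrib)
  show ?thesis
    unfolding kern_def E add_Suc_right qpoch_Suc D
    using assms by (simp add: divide_simps mult_ac)
qed

text \<open>The pair equation divided by \<open>kern p b c e n k\<close> and cleared of
  denominators, with N = p^n and X = p^k.\<close>

lemma WZ_certificate:
  fixes p b c e N X :: real
  defines "Y \<equiv> N * X" and "M \<equiv> N ^ 3 * X"
  assumes "p \<noteq> 0"
  shows "- ((1 - b * c * e / p * (p * Y) ^ 3) * (N ^ 3 * X ^ 3) *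
        ((b - p\<^sup>2 * N\<^sup>2) * (c - p\<^sup>2 * N\<^sup>2) * (e - p\<^sup>2 * N\<^sup>2)) *
        ((1 - b * Y) * (1 - c * Y) * (1 - e * Y)))
      - (1 - b * c * e / p * Y ^ 3) * (1 - p * M) * (1 - p\<^sup>2 * M) * (1 - p ^ 3 * M) *
        ((1 - b * c * p * Y\<^sup>2) * (1 - b * e * p * Y\<^sup>2) * (1 - c * e * p * Y\<^sup>2)) =
    WZ_H p b c e N (p * X) * (1 - b * c * e / p * X\<^sup>2) * (N ^ 3 * (p * X)) *
        ((1 - b * Y) * (1 - c * Y) * (1 - e * Y))
      - WZ_H p b c e N X * (1 - p ^ 3 * M) *
        ((1 - b * c * p * Y\<^sup>2) * (1 - b * e * p * Y\<^sup>2) * (1 - c * e * p * Y\<^sup>2))"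
proof -
  \<comment> \<open>Writing c = p d turns b c e / p into b d e, after which both sides are
    polynomials.\<close>
  obtain d where c: "c = p * d"
    using assms by (metis nonzero_mult_div_cancel_left times_divide_eq_right)
  have "b * (p * d) * e / p = b * d * e"
    using assms by simp
  then show ?thesis
    unfolding c WZ_H_def Y_def M_def by algebra
qed

text \<open>All four terms are rational multiples of \<open>kern p b c e n k\<close>. Multiplication
  by the common denominator D Q R, nonzero for parameters in these ranges, leaves
  \<open>WZ_certificate\<close>.\<close>

lemma WZ_pair:
  assumes p: "0 < p" "p < 1" and bce: "0 \<le> b" "b < 1" "0 \<le> c" "c < 1" "0 \<le> e" "e < 1"
  shows "WZ_F p b c e (Suc n) k - WZ_F p b c e n k = WZ_G p b c e n (Suc k) - WZ_G p b c e n k"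
proof -
  define N X Y M where "N = p ^ n" and "X = p ^ k" and "Y = N * X" and "M = N ^ 3 * X"
  have Y: "p ^ (n + k) = Y" "p ^ (3 * (n + k)) = Y ^ 3" "p ^ (3 * (Suc n + k)) = (p * Y) ^ 3"
    by (simp_all add: Y_def N_def X_def power_mult_distrib ac_simps flip: power_mult power_add)
  have M: "p ^ (3 * n + k) = M" "p ^ Suc (3 * n + k) = p * M" "p ^ Suc (Suc (3 * n + k)) = p\<^sup>2 * M"
    by (simp_all add: M_def N_def X_def power_add power2_eq_square mult_ac flip: power_mult)
  have Mlt: "p ^ Suc j * M < 1" for j
  proof -
    have "p ^ Suc j * M = p ^ (j + (3 * n + k)) * p"
      by (simp add: M[symmetric] power_add mult_ac)
    also have "\<dots> < 1" using power_mult_less_one[of p p] p by simp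
    finally show ?thesis .
  qed
  have nz: "1 - x * y * p * Y\<^sup>2 \<noteq> 0" if "0 \<le> x" "x < 1" "0 \<le> y" "y < 1" for x y
  proof -
    have "x * y < 1" using that mult_strict_mono[of x 1 y 1] by simp
    then have "p ^ Suc (2 * (n + k)) * (x * y) < 1"
      using p by (intro power_mult_less_one) auto
    moreover have "p ^ Suc (2 * (n + k)) * (x * y) = x * y * p * Y\<^sup>2"
      by (simp only: power_Suc power_even_eq Y) (simp only: mult_ac)
    ultimately show ?thesis by linarith
  qed
  define D where "D = (1 - b * c * p * Y\<^sup>2) * (1 - b * e * p * Y\<^sup>2) * (1 - c * e * p * Y\<^sup>2)"
  have D: "D \<noteq> 0" using nz bce by (simp add: D_def)
  define Q where "Q = qpoch p p (3 * n + k)"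
  have Q: "Q > 0" using p by (simp add: Q_def qpoch_pos)
  define K where "K = kern p b c e n k"
  define L where "L = (1 - b * Y) * (1 - c * Y) * (1 - e * Y)"
  define B where "B = (b - p\<^sup>2 * N\<^sup>2) * (c - p\<^sup>2 * N\<^sup>2) * (e - p\<^sup>2 * N\<^sup>2)"
  define R where "R = (1 - p * M) * (1 - p\<^sup>2 * M) * (1 - p ^ 3 * M)"
  have R: "1 - p * M > 0" "1 - p\<^sup>2 * M > 0" "1 - p ^ 3 * M > 0"
    using Mlt[of 0] Mlt[of 1] Mlt[of 2] by (simp_all add: numeral_eq_Suc)
  have Kn: "kern p b c e (Suc n) k * D = - K * N ^ 3 * X ^ 3 * B * L"
    using kern_Suc_left[of b c p n k e] nz bce
    by (simp add: Y D_def K_def L_def B_def N_def X_def mult_ac)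
  have Kk: "kern p b c e n (Suc k) * D = K * (1 - b * c * e / p * X\<^sup>2) * (N ^ 3 * (p * X)) * L"
    using kern_Suc_right[of b c p n k e] nz bce
    by (simp add: Y D_def K_def L_def N_def X_def mult_ac)
  have idx: "3 * Suc n + k = Suc (Suc (Suc (3 * n + k)))" "3 * n + k + 2 = Suc (Suc (3 * n + k))"
    "3 * n + Suc k + 2 = Suc (Suc (Suc (3 * n + k)))"
    by simp_all
  have Qs: "qpoch p p (3 * Suc n + k) = Q * R" "qpoch p p (3 * n + k + 2) = Q * (1 - p * M) * (1 - p\<^sup>2 * M)"
    "qpoch p p (3 * n + Suc k + 2) = Q * R"
    by (simp_all only: idx qpoch_Suc M Q_def[symmetric] R_def)
       (simp_all add: power2_eq_square power3_eq_cube mult_ac)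
  define a where "a = b * c * e / p"
  have F: "WZ_F p b c e (Suc n) k = (1 - a * (p * Y) ^ 3) * kern p b c e (Suc n) k / (Q * R)"
    "WZ_F p b c e n k = (1 - a * Y ^ 3) * K / Q"
    by (simp_all only: WZ_F_def Qs Y K_def Q_def a_def)
  have G: "WZ_G p b c e n (Suc k) = WZ_H p b c e N (p * X) * kern p b c e n (Suc k) / (Q * R)"
    "WZ_G p b c e n k = WZ_H p b c e N X * K / (Q * (1 - p * M) * (1 - p\<^sup>2 * M))"
    by (simp_all only: WZ_G_def Qs K_def N_def X_def power_Suc)
  \<comment> \<open>Proved for arbitrary nonzero r, s, t, so that the three factors of R stay
    unexpanded.\<close>
  have cancel_raw: "(u / (Q * (r * s * t)) - v / Q) * (D * Q * (r * s * t)) = u * D - v * (r * s * t) * D"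
    "(u / (Q * (r * s * t)) - v / (Q * r * s)) * (D * Q * (r * s * t)) = u * D - v * t * D"
    if "r \<noteq> 0" "s \<noteq> 0" "t \<noteq> 0" for u v r s t
    using that Q by (simp_all add: field_simps)
  have cancel: "(u / (Q * R) - v / Q) * (D * Q * R) = u * D - v * R * D"
    "(u / (Q * R) - v / (Q * (1 - p * M) * (1 - p\<^sup>2 * M))) * (D * Q * R)
      = u * D - v * (1 - p ^ 3 * M) * D" for u v
    unfolding R_def by (rule cancel_raw; use R in simp)+
  have "(WZ_F p b c e (Suc n) k - WZ_F p b c e n k) * (D * Q * R) =
      (1 - a * (p * Y) ^ 3) * (kern p b c e (Suc n) k * D) - (1 - a * Y ^ 3) * K * R * D"
    unfolding F cancel by (simp only: mult_ac)
  also have "\<dots> = K * (- ((1 - a * (p * Y) ^ 3) * (N ^ 3 * X ^ 3) * B * L)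
      - (1 - a * Y ^ 3) * (1 - p * M) * (1 - p\<^sup>2 * M) * (1 - p ^ 3 * M) * D)"
    unfolding Kn R_def by (simp add: right_diff_distrib mult_ac)
  also have "\<dots> = K * (WZ_H p b c e N (p * X) * (1 - a * X\<^sup>2) * (N ^ 3 * (p * X)) * L
      - WZ_H p b c e N X * (1 - p ^ 3 * M) * D)"
    using WZ_certificate[of p b c e N X] p
    by (simp only: Y_def M_def D_def B_def L_def a_def)
  also have "\<dots> = WZ_H p b c e N (p * X) * (kern p b c e n (Suc k) * D)
      - WZ_H p b c e N X * K * (1 - p ^ 3 * M) * D"
    unfolding Kk a_def by (simp add: right_diff_distrib mult_ac)
  also have "\<dots> = (WZ_G p b c e n (Suc k) - WZ_G p b c e n k) * (D * Q * R)"
    unfolding G cancel by (simp only: mult_ac)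
  finally show ?thesis
    using D Q R by (simp add: R_def)
qed

section \<open>Bounds uniform in the parameters, and the double telescoping\<close>

locale quad_params =
  fixes p b c e :: real
  assumes p: "0 < p" "p < 1"
    and b: "0 \<le> b" "b < 1" and c: "0 \<le> c" "c < 1" and e: "0 \<le> e" "e < 1"
    and bce: "b * c * e \<le> p"
begin

abbreviation "d \<equiv> qpoch_inf p p"

lemma d_pos: "0 < d"
  using p by (intro qpoch_inf_pos)

text \<open>The condition b c e <= p is exactly the upper bound; it keeps every (a;p^2)_k in
  [0,1].\<close>

lemma a_bounds: "0 \<le> b * c * e / p" "b * c * e / p \<le> 1"
  using p b c e bce by auto

text \<open>Every numerator factor has absolute value at most 1, and each of the three denominators
  is at least \<open>d\<close>. Of the quadratic exponent in k only p^k is kept, so the bound is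
  geometric in k. It does not involve b, c, e, which later allows a dominated passage to b = c = e =
  0.\<close>

lemma kern_bound: "\<bar>kern p b c e n k\<bar> \<le> p ^ (3 * (\<Sum>i<n. i)) * p ^ k / d ^ 3"
proof -
  have diff: "\<bar>x - p\<^sup>2 * (p ^ j)\<^sup>2\<bar> \<le> 1" if "0 \<le> x" "x < 1" for x j
  proof -
    have "0 \<le> p\<^sup>2 * (p ^ j)\<^sup>2" "p\<^sup>2 * (p ^ j)\<^sup>2 \<le> 1"
      using p by (auto intro!: mult_le_one power_le_one)
    with that show ?thesis by linarith
  qed
  have P1: "\<bar>\<Prod>j<n. (b - p\<^sup>2 * (p ^ j)\<^sup>2) * (c - p\<^sup>2 * (p ^ j)\<^sup>2) * (e - p\<^sup>2 * (p ^ j)\<^sup>2)\<bar> \<le> 1"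
    unfolding abs_prod abs_mult using b c e
    by (intro prod_le_1 conjI mult_le_one mult_nonneg_nonneg abs_ge_zero diff)
  have k: "k \<le> 3 * n * k + (\<Sum>i\<le>k. i)"
    by (cases k) auto
  have P2: "\<bar>qpoch (b * c * e / p) (p\<^sup>2) k * p ^ (3 * n * k + (\<Sum>i\<le>k. i))\<bar> \<le> 1 * p ^ k"
    unfolding abs_mult
  proof (rule mult_mono)
    show "\<bar>qpoch (b * c * e / p) (p\<^sup>2) k\<bar> \<le> 1"
      using p a_bounds by (simp add: qpoch_nonneg qpoch_le_1 power_le_one)
    show "\<bar>p ^ (3 * n * k + (\<Sum>i\<le>k. i))\<bar> \<le> p ^ k"
      using p k by (simp add: power_decreasing)
  qed auto
  have P3: "\<bar>qpoch b p m * qpoch c p m * qpoch e p m\<bar> \<le> 1" for m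
    unfolding abs_mult using p b c e
    by (intro mult_le_one mult_nonneg_nonneg abs_ge_zero) (simp_all add: qpoch_nonneg qpoch_le_1)
  have den: "d \<le> qpoch (x * y * p) (p\<^sup>2) m" if "0 \<le> x" "x < 1" "0 \<le> y" "y < 1" for x y m
    using that p by (intro qpoch_square_base_ge) (auto simp: mult_le_one mult_left_le_one_le)
  let ?D = "\<lambda>m. qpoch (b * c * p) (p\<^sup>2) m * qpoch (b * e * p) (p\<^sup>2) m * qpoch (c * e * p) (p\<^sup>2) m"
  have P4: "d ^ 3 \<le> ?D m" for m
  proof -
    have "d * d * d \<le> ?D m"
      using d_pos by (intro mult_mono den b c e mult_nonneg_nonneg order.trans[OF less_imp_le[OF d_pos] den]) auto
    then show ?thesis by (simp add: power3_eq_cube)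
  qed
  have D: "0 < ?D m" for m
    using P4[of m] d_pos by (meson less_le_trans zero_less_power)
  let ?R = "\<Prod>j<n. (b - p\<^sup>2 * (p ^ j)\<^sup>2) * (c - p\<^sup>2 * (p ^ j)\<^sup>2) * (e - p\<^sup>2 * (p ^ j)\<^sup>2)"
  let ?A = "qpoch (b * c * e / p) (p\<^sup>2) k * p ^ (3 * n * k + (\<Sum>i\<le>k. i))"
  let ?B = "qpoch b p (n + k) * qpoch c p (n + k) * qpoch e p (n + k)"
  have "\<bar>kern p b c e n k\<bar> = p ^ (3 * (\<Sum>i<n. i)) * (\<bar>?R\<bar> * \<bar>?A\<bar> * \<bar>?B\<bar>) / ?D (n + k)"
    using p by (simp only: kern_def abs_divide abs_of_pos[OF D]) (simp add: abs_mult power_abs mult_ac)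
  also have "\<dots> \<le> p ^ (3 * (\<Sum>i<n. i)) * (1 * (1 * p ^ k) * 1) / d ^ 3"
    using p d_pos by (intro frac_le mult_left_mono mult_mono P1 P2 P3 P4) auto
  finally show ?thesis by simp
qed

lemma qpoch_p_ge: "d \<le> qpoch p p m"
  using p by (intro qpoch_inf_le_qpoch) auto

text \<open>One estimate for \<open>WZ_F\<close>, \<open>WZ_G\<close> and the antidifference in
  \<open>quad_sum_shift\<close>; the fourth factor \<open>d\<close> comes from (p;p)_m.\<close>

lemma kern_frac_bound:
  assumes "\<bar>u\<bar> \<le> C"
  shows "\<bar>u * kern p b c e n k / qpoch p p m\<bar> \<le> p ^ (3 * (\<Sum>i<n. i)) * p ^ k * (C / d ^ 4)"
proof -
  have "0 < qpoch p p m"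
    using qpoch_p_ge d_pos by (rule less_le_trans[rotated])
  then have "\<bar>u * kern p b c e n k / qpoch p p m\<bar> = \<bar>u\<bar> * \<bar>kern p b c e n k\<bar> / qpoch p p m"
    by (simp add: abs_mult)
  also have "\<dots> \<le> C * (p ^ (3 * (\<Sum>i<n. i)) * p ^ k / d ^ 3) / d"
    using p d_pos assms by (intro frac_le mult_mono kern_bound qpoch_p_ge) auto
  also have "\<dots> = p ^ (3 * (\<Sum>i<n. i)) * p ^ k * (C / d ^ 4)"
    by (simp add: eval_nat_numeral mult_ac)
  finally show ?thesis .
qed

lemma WZ_F_bound: "\<bar>WZ_F p b c e n k\<bar> \<le> p ^ (3 * (\<Sum>i<n. i)) * p ^ k * (1 / d ^ 4)"
  unfolding WZ_F_def
proof (rule kern_frac_bound)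
  have "0 \<le> b * c * e / p * p ^ (3 * (n + k))" "b * c * e / p * p ^ (3 * (n + k)) \<le> 1"
    using a_bounds p by (simp_all only: mult_nonneg_nonneg mult_le_one power_le_one zero_le_power less_imp_le)
  then show "\<bar>1 - b * c * e / p * p ^ (3 * (n + k))\<bar> \<le> 1"
    by linarith
qed

text \<open>The three terms of \<open>WZ_H\<close> are at most 3, 3 and 6 in absolute value; any
  constant independent of n and k would serve.\<close>

lemma WZ_H_bound:
  assumes "0 \<le> N" "N \<le> 1" "0 \<le> X" "X \<le> 1"
  shows "\<bar>WZ_H p b c e N X\<bar> \<le> 12"
proof -
  have unit: "0 \<le> x * y \<and> x * y \<le> 1" if "0 \<le> x \<and> x \<le> 1" "0 \<le> y \<and> y \<le> 1" for x y :: real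
    using that by (simp add: mult_le_one)
  have unitp: "0 \<le> x ^ j \<and> x ^ j \<le> 1" if "0 \<le> x \<and> x \<le> 1" for x :: real and j
    using that by (simp add: power_le_one)
  have base: "0 \<le> p \<and> p \<le> 1" "0 \<le> N \<and> N \<le> 1" "0 \<le> X \<and> X \<le> 1"
    "0 \<le> b \<and> b \<le> 1" "0 \<le> c \<and> c \<le> 1" "0 \<le> e \<and> e \<le> 1"
    using assms p b c e by auto
  let ?M = "N ^ 3 * X"
  have m: "0 \<le> p\<^sup>2 * ?M \<and> p\<^sup>2 * ?M \<le> 1" "0 \<le> p ^ 3 * ?M\<^sup>2 \<and> p ^ 3 * ?M\<^sup>2 \<le> 1"
    "0 \<le> p * ?M \<and> p * ?M \<le> 1"
    by (intro unit unitp base)+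
  have a: "0 \<le> b * c * e / p * (N * X) ^ 3 \<and> b * c * e / p * (N * X) ^ 3 \<le> 1"
    by (intro unit unitp base) (use a_bounds in auto)
  have y: "0 \<le> p * N\<^sup>2 * (N * X)\<^sup>2 \<and> p * N\<^sup>2 * (N * X)\<^sup>2 \<le> 1" "0 \<le> N * X \<and> N * X \<le> 1"
    by (intro unit unitp base)+
  have s: "0 \<le> b * c \<and> b * c \<le> 1" "0 \<le> b * e \<and> b * e \<le> 1" "0 \<le> c * e \<and> c * e \<le> 1"
    by (intro unit base)+
  have prod: "\<bar>x * z\<bar> \<le> C" if "0 \<le> x \<and> x \<le> 1" "\<bar>z\<bar> \<le> C" for x z C :: real
    using that mult_mono[of "\<bar>x\<bar>" 1 "\<bar>z\<bar>" C] by (simp add: abs_mult)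
  have "\<bar>(b * c + b * e + c * e) * (N * X)\<bar> \<le> 3"
    using prod[OF y(2), of "b * c + b * e + c * e" 3] s by (simp add: mult.commute)
  then have "\<bar>(b + c + e) - (b * c + b * e + c * e) * (N * X)\<bar> \<le> 6"
    using base by linarith
  then have 1: "\<bar>p * N\<^sup>2 * (N * X)\<^sup>2 * ((b + c + e) - (b * c + b * e + c * e) * (N * X))\<bar> \<le> 6"
    by (intro prod y)
  have 2: "\<bar>b * c * e / p * (N * X) ^ 3 * (1 - p * ?M + p ^ 3 * ?M\<^sup>2)\<bar> \<le> 3"
    using m by (intro prod a) linarith
  show ?thesis
    unfolding WZ_H_def using 1 2 m by linarith
qed

lemma WZ_G_bound: "\<bar>WZ_G p b c e n k\<bar> \<le> p ^ (3 * (\<Sum>i<n. i)) * p ^ k * (12 / d ^ 4)"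
  unfolding WZ_G_def using p by (intro kern_frac_bound WZ_H_bound) (auto simp: power_le_one)

lemma summable_WZ_F: "summable (WZ_F p b c e n)"
proof (rule summable_comparison_test')
  show "summable (\<lambda>k. p ^ (3 * (\<Sum>i<n. i)) * p ^ k * (1 / d ^ 4))"
    using p by (intro summable_mult summable_mult2 summable_geometric) auto
qed (use WZ_F_bound in simp)

lemma WZ_G_tendsto_0: "WZ_G p b c e n \<longlonglongrightarrow> 0"
proof (rule Lim_null_comparison)
  have "(\<lambda>k. p ^ (3 * (\<Sum>i<n. i)) * p ^ k * (12 / d ^ 4)) \<longlonglongrightarrow> p ^ (3 * (\<Sum>i<n. i)) * 0 * (12 / d ^ 4)"
    using p by (intro tendsto_intros LIMSEQ_power_zero) auto
  then show "(\<lambda>k. p ^ (3 * (\<Sum>i<n. i)) * p ^ k * (12 / d ^ 4)) \<longlonglongrightarrow> 0"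
    by simp
qed (use WZ_G_bound in simp)

lemma suminf_WZ_F_tendsto_0: "(\<lambda>n. \<Sum>k. WZ_F p b c e n k) \<longlonglongrightarrow> 0"
\<comment> \<open>At n + 1 the exponent 3 (0 + ... + n) is at least n, so the row sums are at most a
  constant times p^n.\<close>
proof (rule LIMSEQ_imp_Suc, rule Lim_null_comparison)
  have geo: "(\<lambda>k. p ^ k * C) sums (1 / (1 - p) * C)" for C
    using p by (intro sums_mult2 geometric_sums) auto
  have "\<bar>\<Sum>k. WZ_F p b c e (Suc n) k\<bar> \<le> p ^ n * (1 / (1 - p) * (1 / d ^ 4))" for n
  proof -
    have n: "p ^ (3 * (\<Sum>i<Suc n. i)) \<le> p ^ n"
      using p by (intro power_decreasing) auto
    have bd: "\<bar>WZ_F p b c e (Suc n) k\<bar> \<le> p ^ n * (p ^ k * (1 / d ^ 4))" for k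
      using WZ_F_bound[of "Suc n" k] mult_right_mono[OF n, of "p ^ k * (1 / d ^ 4)"] p d_pos
      by (simp add: mult_ac)
    have sm: "(\<lambda>k. p ^ n * (p ^ k * (1 / d ^ 4))) sums (p ^ n * (1 / (1 - p) * (1 / d ^ 4)))"
      by (intro sums_mult geo)
    have "norm (\<Sum>k. WZ_F p b c e (Suc n) k) \<le> (\<Sum>k. p ^ n * (p ^ k * (1 / d ^ 4)))"
      by (rule norm_suminf_le[OF _ sums_summable[OF sm]]) (use bd in simp)
    then show ?thesis
      by (simp only: sums_unique[OF sm, symmetric] real_norm_def)
  qed
  then show "\<forall>\<^sub>F n in sequentially. norm (\<Sum>k. WZ_F p b c e (Suc n) k) \<le> p ^ n * (1 / (1 - p) * (1 / d ^ 4))"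
    by simp
  have "(\<lambda>n. p ^ n * (1 / (1 - p) * (1 / d ^ 4))) \<longlonglongrightarrow> 0 * (1 / (1 - p) * (1 / d ^ 4))"
    using p by (intro tendsto_intros LIMSEQ_power_zero) auto
  then show "(\<lambda>n. p ^ n * (1 / (1 - p) * (1 / d ^ 4))) \<longlonglongrightarrow> 0"
    by simp
qed

text \<open>Summing the pair equation over k leaves -G(n,0) on the right, because G(n,k) tends to 0
  in k. Hence G(n,0) is a difference of consecutive row sums, and the sum over n telescopes as
  well.\<close>

theorem WZ_G_sums: "(\<lambda>n. WZ_G p b c e n 0) sums (\<Sum>k. WZ_F p b c e 0 k)"
proof -
  have "WZ_G p b c e n 0 = (\<Sum>k. WZ_F p b c e n k) - (\<Sum>k. WZ_F p b c e (Suc n) k)" for n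
  proof -
    have eq: "WZ_F p b c e n k - WZ_F p b c e (Suc n) k = WZ_G p b c e n k - WZ_G p b c e n (Suc k)" for k
      using WZ_pair[OF p b c e, of n k] by linarith
    have "(\<lambda>k. WZ_F p b c e n k - WZ_F p b c e (Suc n) k) sums WZ_G p b c e n 0"
      unfolding eq using telescope_sums'[OF WZ_G_tendsto_0[of n]] by simp
    moreover have "(\<lambda>k. WZ_F p b c e n k - WZ_F p b c e (Suc n) k) sums
        ((\<Sum>k. WZ_F p b c e n k) - (\<Sum>k. WZ_F p b c e (Suc n) k))"
      by (intro sums_diff summable_sums summable_WZ_F)
    ultimately show ?thesis by (rule sums_unique2)
  qed
  then show ?thesis
    using telescope_sums'[OF suminf_WZ_F_tendsto_0] by simp
qed

end

section \<open>The quadratic summation\<close>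

definition quad_sum :: "real \<Rightarrow> real \<Rightarrow> real \<Rightarrow> real \<Rightarrow> real" where
  "quad_sum p b c e = (\<Sum>k. WZ_F p b c e 0 k)"

lemma quad_sum_commute: "quad_sum p b c e = quad_sum p c b e" "quad_sum p b c e = quad_sum p e c b"
  by (simp_all add: quad_sum_def WZ_F_def kern_def mult_ac)

text \<open>The Gosper equation for the shift of b to p^2 b, with X = p^k: on the left the summands
  for b and for p^2 b, on the right the two values of the antidifference \<open>g\<close> from
  \<open>quad_sum_shift\<close>, all divided by common factors.\<close>

lemma quad_certificate:
  fixes p b c e X :: real
  assumes "p \<noteq> 0"
  defines "a \<equiv> b * c * e / p"
  shows "(1 - b) * (1 - a * X ^ 3) * ((1 - b * c * p * X\<^sup>2) * (1 - b * e * p * X\<^sup>2))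
      - (1 - p\<^sup>2 * a * X ^ 3) * ((1 - a * X\<^sup>2) * (1 - b * X) * (1 - p * b * X)) =
    (1 - a * X\<^sup>2) * ((1 - b * X) * (1 - c * X) * (1 - e * X)) * (p * X) * b
      - (1 - X) * (b - a * X\<^sup>2) * ((1 - b * c * p * X\<^sup>2) * (1 - b * e * p * X\<^sup>2))"
proof -
  obtain d where c: "c = p * d"
    using assms by (metis nonzero_mult_div_cancel_left times_divide_eq_right)
  have "b * (p * d) * e / p = b * d * e"
    using assms by simp
  then show ?thesis
    unfolding c a_def by algebra
qed

text \<open>Replacing b by p^2 b moves a, b c p and b e p by one step of the base p^2, and b by two
  steps of the base p. Each shifted factorial then changes only in its end factors, by
  \<open>qpoch_shift\<close>.\<close>

lemma kern_shift_param:
  fixes p b c e :: real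
  defines "a \<equiv> b * c * e / p"
  assumes "b * c * p \<noteq> 1" "b * e * p \<noteq> 1"
    "1 - b * c * p * (p ^ k)\<^sup>2 \<noteq> 0" "1 - b * e * p * (p ^ k)\<^sup>2 \<noteq> 0"
  shows "kern p (p\<^sup>2 * b) c e 0 k * ((1 - a) * (1 - b) * (1 - p * b)) *
      ((1 - b * c * p * (p ^ k)\<^sup>2) * (1 - b * e * p * (p ^ k)\<^sup>2)) =
    kern p b c e 0 k * ((1 - a * (p ^ k)\<^sup>2) * (1 - b * p ^ k) * (1 - p * b * p ^ k)) *
      ((1 - b * c * p) * (1 - b * e * p))"
proof -
  have D: "(p\<^sup>2) ^ k = (p ^ k)\<^sup>2"
    by (simp add: power_mult[symmetric] mult.commute)
  have sq: "(1 - x) * qpoch (p\<^sup>2 * x) (p\<^sup>2) k = qpoch x (p\<^sup>2) k * (1 - x * (p ^ k)\<^sup>2)" for x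
    using qpoch_shift[of x "p\<^sup>2" k] by (simp only: D mult.commute[of "(p ^ k)\<^sup>2"])
  have "(1 - b) * (1 - p * b) * qpoch (p\<^sup>2 * b) p k = (1 - b) * ((1 - p * b) * qpoch (p * (p * b)) p k)"
    by (simp add: power2_eq_square mult_ac)
  also have "\<dots> = ((1 - b) * qpoch (p * b) p k) * (1 - p ^ k * (p * b))"
    by (simp only: qpoch_shift[of "p * b"] mult.assoc)
  also have "\<dots> = qpoch b p k * ((1 - b * p ^ k) * (1 - p * b * p ^ k))"
    unfolding qpoch_shift by (simp add: mult_ac)
  finally have 1: "(1 - b) * (1 - p * b) * qpoch (p\<^sup>2 * b) p k =
    qpoch b p k * ((1 - b * p ^ k) * (1 - p * b * p ^ k))" .
  have den: "qpoch (p\<^sup>2 * x) (p\<^sup>2) k = qpoch x (p\<^sup>2) k * (1 - x * (p ^ k)\<^sup>2) / (1 - x)" if "x \<noteq> 1" for x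
    using sq[of x] that by (simp add: field_simps)
  define A A' B B' where "A = qpoch a (p\<^sup>2) k" and "A' = qpoch (p\<^sup>2 * a) (p\<^sup>2) k"
    and "B = qpoch b p k" and "B' = qpoch (p\<^sup>2 * b) p k"
  define C where "C = p ^ (\<Sum>i\<le>k. i) * (qpoch c p k * qpoch e p k) / qpoch (c * e * p) (p\<^sup>2) k"
  define u v where "u = qpoch (b * c * p) (p\<^sup>2) k" and "v = qpoch (b * e * p) (p\<^sup>2) k"
  define u1 v1 where "u1 = 1 - b * c * p * (p ^ k)\<^sup>2" and "v1 = 1 - b * e * p * (p ^ k)\<^sup>2"
  define u0 v0 where "u0 = 1 - b * c * p" and "v0 = 1 - b * e * p"
  have args: "p\<^sup>2 * b * c * e / p = p\<^sup>2 * a" "p\<^sup>2 * b * c * p = p\<^sup>2 * (b * c * p)"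
    "p\<^sup>2 * b * e * p = p\<^sup>2 * (b * e * p)"
    by (simp_all add: a_def mult_ac)
  have K: "kern p b c e 0 k = A * B * C / (u * v)"
    by (simp add: kern_def A_def B_def C_def u_def v_def a_def mult_ac)
  have K': "kern p (p\<^sup>2 * b) c e 0 k = A' * B' * C / ((u * u1 / u0) * (v * v1 / v0))"
    unfolding kern_def args add_0 den[OF assms(2)] den[OF assms(3)]
    by (simp add: A'_def B'_def C_def u_def v_def u1_def v1_def u0_def v0_def mult_ac)
  have nz: "u0 \<noteq> 0" "v0 \<noteq> 0" "u1 \<noteq> 0" "v1 \<noteq> 0"
    using assms by (auto simp: u0_def v0_def u1_def v1_def)
  have "kern p (p\<^sup>2 * b) c e 0 k * ((1 - a) * (1 - b) * (1 - p * b)) * (u1 * v1) =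
      ((1 - a) * A') * ((1 - b) * (1 - p * b) * B') * C / (u * v) * (u0 * v0)"
    unfolding K' using nz by (simp add: divide_simps)
  also have "(1 - a) * A' = A * (1 - a * (p ^ k)\<^sup>2)"
    by (simp only: A_def A'_def sq)
  also have "(1 - b) * (1 - p * b) * B' = B * ((1 - b * p ^ k) * (1 - p * b * p ^ k))"
    by (simp only: B_def B'_def 1)
  finally show ?thesis
    by (simp add: K u0_def v0_def u1_def v1_def mult_ac)
qed

context quad_params
begin

lemma prod_lt_1:
  assumes "0 \<le> x" "x < 1" "0 \<le> y" "y < 1"
  shows "x * y * p * (p ^ k)\<^sup>2 < 1"
proof -
  have "x * y < 1"
    using assms mult_strict_mono[of x 1 y 1] by simp
  then have "p ^ Suc (2 * k) * (x * y) < 1"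
    using p by (intro power_mult_less_one) auto
  also have "p ^ Suc (2 * k) * (x * y) = x * y * p * (p ^ k)\<^sup>2"
    by (simp only: power_Suc power_even_eq) (simp only: mult_ac)
  finally show ?thesis .
qed

lemma quad_params_scale:
  assumes r: "0 \<le> r" "r \<le> 1" and s: "0 \<le> s" "s \<le> 1" and t: "0 \<le> t" "t \<le> 1"
  shows "quad_params p (r * b) (s * c) (t * e)"
proof
  have le: "r * b \<le> b" "s * c \<le> c" "t * e \<le> e"
    using assms b c e by (simp_all add: mult_left_le_one_le)
  then show "r * b < 1" "s * c < 1" "t * e < 1"
    using b c e by linarith+
  have "(r * b) * (s * c) * (t * e) \<le> b * c * e"
    using le assms b c e by (intro mult_mono mult_nonneg_nonneg) auto
  then show "(r * b) * (s * c) * (t * e) \<le> p"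
    using bce by linarith
qed (use assms p b c e in auto)

text \<open>The weighted difference of the two summands is a difference of \<open>g\<close> in k.
  Since g(0) = 0 and g tends to 0, it sums to 0, and the nonzero factor 1 - b can be
  cancelled.\<close>

lemma quad_sum_shift:
  "(1 - b * c * p) * (1 - b * e * p) * quad_sum p b c e =
   (1 - b * p) * (1 - b * c * e / p) * quad_sum p (p\<^sup>2 * b) c e"
proof -
  interpret shifted: quad_params p "p\<^sup>2 * b" c e
    using quad_params_scale[of "p\<^sup>2" 1 1] p by (simp add: power_le_one)
  define a where "a = b * c * e / p"
  \<comment> \<open>For k > 0, 1 - p^k is the last factor of (p;p)_k, and b - a p^(2k) is b times
    the last factor of (c e p;p^2)_k, so both cancel against denominators. At k = 0 the factor 1 -
    p^k gives g(0) = 0.\<close>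
  define g where "g k = kern p b c e 0 k / qpoch p p k * ((1 - p ^ k) * (b - a * (p ^ k)\<^sup>2))" for k
  have step: "(1 - b) * ((1 - b * c * p) * (1 - b * e * p) * WZ_F p b c e 0 k
      - (1 - b * p) * (1 - a) * WZ_F p (p\<^sup>2 * b) c e 0 k) =
      (1 - b * c * p) * (1 - b * e * p) * (g (Suc k) - g k)" for k
  proof -
    define X where "X = p ^ k"
    define K K' K1 Q where "K = kern p b c e 0 k" and "K' = kern p (p\<^sup>2 * b) c e 0 k"
      and "K1 = kern p b c e 0 (Suc k)" and "Q = qpoch p p k"
    define U where "U = (1 - b * c * p) * (1 - b * e * p)"
    define D where "D = (1 - b * c * p * X\<^sup>2) * (1 - b * e * p * X\<^sup>2)"
    define L where "L = (1 - b * X) * (1 - c * X) * (1 - e * X)"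
    define E where "E = 1 - c * e * p * X\<^sup>2"
    have nz: "1 - b * c * p * X\<^sup>2 \<noteq> 0" "1 - b * e * p * X\<^sup>2 \<noteq> 0" "1 - c * e * p * X\<^sup>2 \<noteq> 0"
      using prod_lt_1[of b c k] prod_lt_1[of b e k] prod_lt_1[of c e k] b c e by (auto simp: X_def)
    then have DE: "D \<noteq> 0" "E \<noteq> 0" by (auto simp: D_def E_def)
    have U: "b * c * p \<noteq> 1" "b * e * p \<noteq> 1"
      using prod_lt_1[of b c 0] prod_lt_1[of b e 0] b c e by auto
    have Q: "Q > 0" using p by (simp add: Q_def qpoch_pos)
    have pX: "1 - p * X > 0"
      using power_mult_less_one[of p p k] p by (simp add: X_def mult.commute)
    have Qs: "qpoch p p (Suc k) = Q * (1 - p * X)"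
      by (simp add: Q_def X_def mult.commute)
    have F: "WZ_F p b c e 0 k = (1 - a * X ^ 3) * K / Q"
      by (simp add: WZ_F_def a_def X_def K_def Q_def power_mult[symmetric] mult.commute[of 3])
    have arg: "p\<^sup>2 * b * c * e / p = p\<^sup>2 * a"
      by (simp add: a_def)
    have F': "WZ_F p (p\<^sup>2 * b) c e 0 k = (1 - p\<^sup>2 * a * X ^ 3) * K' / Q"
      unfolding WZ_F_def arg by (simp add: X_def K'_def Q_def power_mult[symmetric] mult.commute[of 3])
    have K': "K' * ((1 - a) * (1 - b) * (1 - p * b)) * D =
        K * ((1 - a * X\<^sup>2) * (1 - b * X) * (1 - p * b * X)) * U"
      using kern_shift_param[of b c p e k] U nz
      by (simp only: X_def K_def K'_def D_def U_def a_def) simp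
    have "K1 * (D * E) = K * (1 - a * X\<^sup>2) * (p * X) * L"
      using kern_Suc_right[of b c p 0 k e] nz
      by (simp add: X_def K_def K1_def D_def E_def L_def a_def)
    moreover have "b - a * (p ^ Suc k)\<^sup>2 = b * E"
      using p by (simp add: a_def E_def X_def power2_eq_square field_simps)
    ultimately have K1: "K1 * (b - a * (p ^ Suc k)\<^sup>2) * D = K * ((1 - a * X\<^sup>2) * L * (p * X) * b)"
      by (metis (no_types, lifting) mult.assoc mult.commute)
    have g1: "g (Suc k) = K1 * (b - a * (p ^ Suc k)\<^sup>2) / Q"
      using pX by (simp only: g_def Qs K1_def power_Suc X_def[symmetric]) simp
    have g0: "g k = K * ((1 - X) * (b - a * X\<^sup>2)) / Q"
      by (simp add: g_def K_def Q_def X_def)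
    have gen: "x * (U * (A / Q) - y * z * (B / Q)) * D = (U * x * A * D - B * (z * x * y) * D) / Q"
      for x y z A B using Q by (simp add: field_simps)
    have gen2: "(U * x * (A * K) * D - s * (K * T * U)) / Q = U * (K * (x * A * D - s * T)) / Q"
      for x A s T by (simp add: algebra_simps)
    have "(1 - b) * (U * WZ_F p b c e 0 k - (1 - b * p) * (1 - a) * WZ_F p (p\<^sup>2 * b) c e 0 k) * D =
      (U * (1 - b) * ((1 - a * X ^ 3) * K) * D
        - (1 - p\<^sup>2 * a * X ^ 3) * (K' * ((1 - a) * (1 - b) * (1 - p * b)) * D)) / Q"
      unfolding F F' gen by (simp only: mult_ac)
    also have "\<dots> = U * (K * ((1 - b) * (1 - a * X ^ 3) * D
        - (1 - p\<^sup>2 * a * X ^ 3) * ((1 - a * X\<^sup>2) * (1 - b * X) * (1 - p * b * X)))) / Q"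
      unfolding K' gen2 ..
    also have "\<dots> = U * (K * ((1 - a * X\<^sup>2) * L * (p * X) * b
        - (1 - X) * (b - a * X\<^sup>2) * D)) / Q"
      using quad_certificate[of p b c e X] p by (simp only: a_def D_def L_def)
    also have "\<dots> = U * (K1 * (b - a * (p ^ Suc k)\<^sup>2) * D - K * ((1 - X) * (b - a * X\<^sup>2)) * D) / Q"
      unfolding K1 by (simp only: right_diff_distrib[of K] mult.assoc)
    also have "\<dots> = U * (g (Suc k) - g k) * D"
      unfolding g1 g0 by (simp add: diff_divide_distrib left_diff_distrib right_diff_distrib mult_ac)
    finally show ?thesis
      using DE by (simp only: U_def) simp
  qed
  have "g \<longlonglongrightarrow> 0"
  proof (rule Lim_null_comparison)
    have "\<bar>(1 - p ^ k) * (b - a * (p ^ k)\<^sup>2)\<bar> \<le> 1 * 1" for k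
      unfolding abs_mult
    proof (rule mult_mono)
      show "\<bar>1 - p ^ k\<bar> \<le> 1" using p by (simp add: power_le_one)
      have "0 \<le> a * (p ^ k)\<^sup>2" "a * (p ^ k)\<^sup>2 \<le> 1"
        using a_bounds[folded a_def] p by (auto intro!: mult_nonneg_nonneg mult_le_one power_le_one)
      then show "\<bar>b - a * (p ^ k)\<^sup>2\<bar> \<le> 1" using b by linarith
    qed auto
    then have "\<bar>g k\<bar> \<le> p ^ k * (1 / d ^ 4)" for k
      using kern_frac_bound[of "(1 - p ^ k) * (b - a * (p ^ k)\<^sup>2)" 1 0 k k] by (simp add: g_def mult_ac)
    then show "\<forall>\<^sub>F k in sequentially. norm (g k) \<le> p ^ k * (1 / d ^ 4)"
      by simp
    have "(\<lambda>k. p ^ k * (1 / d ^ 4)) \<longlonglongrightarrow> 0 * (1 / d ^ 4)"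
      using p by (intro tendsto_intros LIMSEQ_power_zero) auto
    then show "(\<lambda>k. p ^ k * (1 / d ^ 4)) \<longlonglongrightarrow> 0" by simp
  qed
  then have "(\<lambda>k. (1 - b * c * p) * (1 - b * e * p) * (g (Suc k) - g k)) sums
      ((1 - b * c * p) * (1 - b * e * p) * (0 - g 0))"
    by (intro sums_mult telescope_sums)
  moreover have "(\<lambda>k. (1 - b * c * p) * (1 - b * e * p) * (g (Suc k) - g k)) sums
     ((1 - b) * ((1 - b * c * p) * (1 - b * e * p) * quad_sum p b c e
      - (1 - b * p) * (1 - a) * quad_sum p (p\<^sup>2 * b) c e))"
    unfolding step[symmetric] quad_sum_def
    by (intro sums_mult sums_diff summable_sums summable_WZ_F shifted.summable_WZ_F)
  moreover have "g 0 = 0" by (simp add: g_def)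
  ultimately have "(1 - b) * ((1 - b * c * p) * (1 - b * e * p) * quad_sum p b c e
      - (1 - b * p) * (1 - a) * quad_sum p (p\<^sup>2 * b) c e) = 0"
    using sums_unique2 by fastforce
  then show ?thesis
    using b by (simp add: a_def)
qed

end

section \<open>Iterating the shift down to b = c = e = 0\<close>

context quad_params
begin

lemma quad_sum_shift_iterated:
  "qpoch (b * c * p) (p\<^sup>2) N * qpoch (b * e * p) (p\<^sup>2) N * quad_sum p b c e =
   qpoch (b * p) (p\<^sup>2) N * qpoch (b * c * e / p) (p\<^sup>2) N * quad_sum p ((p\<^sup>2) ^ N * b) c e"
proof (induction N)
  case (Suc N)
  define r where "r = (p\<^sup>2) ^ N"
  interpret shifted: quad_params p "r * b" c e
    using quad_params_scale[of r 1 1] p by (simp add: r_def power_le_one)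
  have "qpoch (b * c * p) (p\<^sup>2) (Suc N) * qpoch (b * e * p) (p\<^sup>2) (Suc N) * quad_sum p b c e =
    (1 - r * (b * c * p)) * (1 - r * (b * e * p)) *
    (qpoch (b * c * p) (p\<^sup>2) N * qpoch (b * e * p) (p\<^sup>2) N * quad_sum p b c e)"
    by (simp only: qpoch_Suc r_def mult_ac)
  also have "\<dots> = qpoch (b * p) (p\<^sup>2) N * qpoch (b * c * e / p) (p\<^sup>2) N *
    ((1 - r * b * c * p) * (1 - r * b * e * p) * quad_sum p (r * b) c e)"
    unfolding Suc r_def[symmetric] by (simp only: mult_ac)
  also have "\<dots> = qpoch (b * p) (p\<^sup>2) N * qpoch (b * c * e / p) (p\<^sup>2) N *
    ((1 - r * b * p) * (1 - r * b * c * e / p) * quad_sum p (p\<^sup>2 * (r * b)) c e)"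
    unfolding shifted.quad_sum_shift ..
  also have "\<dots> = qpoch (b * p) (p\<^sup>2) (Suc N) * qpoch (b * c * e / p) (p\<^sup>2) (Suc N) *
      quad_sum p ((p\<^sup>2) ^ Suc N * b) c e"
    by (simp add: r_def mult_ac)
  finally show ?case .
qed simp

lemma quad_params_swap: "quad_params p c b e" "quad_params p e c b"
  using quad_params_axioms by (auto simp: quad_params_def mult_ac)

text \<open>The N-fold shift is applied to b, then c, then e. Each product of two parameters is
  moved in two of the three rounds and a in all three, hence the lengths 2N and 3N.\<close>

lemma quad_sum_shift_all:
  fixes N :: nat
  defines "r \<equiv> (p\<^sup>2) ^ N"
  shows "qpoch (b * c * p) (p\<^sup>2) (N + N) * qpoch (b * e * p) (p\<^sup>2) (N + N) *
      qpoch (c * e * p) (p\<^sup>2) (N + N) * quad_sum p b c e =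
    qpoch (b * p) (p\<^sup>2) N * qpoch (c * p) (p\<^sup>2) N * qpoch (e * p) (p\<^sup>2) N *
      qpoch (b * c * e / p) (p\<^sup>2) (N + N + N) * quad_sum p (r * b) (r * c) (r * e)"
proof -
  have r: "0 \<le> r" "r \<le> 1"
    using p by (simp_all add: r_def power_le_one)
  have params: "quad_params p (r * b) c e" "quad_params p (r * b) (r * c) e"
    using quad_params_scale[of r 1 1] quad_params_scale[of r r 1] r by simp_all
  interpret s1: quad_params p c "r * b" e
    using params(1) by (rule quad_params.quad_params_swap)
  interpret s2: quad_params p e "r * c" "r * b"
    using params(2) by (rule quad_params.quad_params_swap)
  have A: "qpoch (b * c * p) (p\<^sup>2) N * qpoch (b * e * p) (p\<^sup>2) N * quad_sum p b c e =
     qpoch (b * p) (p\<^sup>2) N * qpoch (b * c * e / p) (p\<^sup>2) N * quad_sum p (r * b) c e"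
    unfolding r_def by (rule quad_sum_shift_iterated)
  have B: "qpoch (r * (b * c * p)) (p\<^sup>2) N * qpoch (c * e * p) (p\<^sup>2) N * quad_sum p (r * b) c e =
     qpoch (c * p) (p\<^sup>2) N * qpoch (r * (b * c * e / p)) (p\<^sup>2) N * quad_sum p (r * b) (r * c) e"
    using s1.quad_sum_shift_iterated[of N]
    unfolding r_def[symmetric] quad_sum_commute(1)[of p c "r * b"] quad_sum_commute(1)[of p "r * c" "r * b"]
    by (simp add: mult_ac)
  have C: "qpoch (r * (b * e * p)) (p\<^sup>2) N * qpoch (r * (c * e * p)) (p\<^sup>2) N *
      quad_sum p (r * b) (r * c) e =
     qpoch (e * p) (p\<^sup>2) N * qpoch (r * (r * (b * c * e / p))) (p\<^sup>2) N *
      quad_sum p (r * b) (r * c) (r * e)"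
    using s2.quad_sum_shift_iterated[of N]
    unfolding r_def[symmetric] quad_sum_commute(2)[of p e "r * c" "r * b"]
      quad_sum_commute(2)[of p "r * e" "r * c" "r * b"]
    by (simp add: mult_ac)
  have two: "qpoch x (p\<^sup>2) (N + N) = qpoch x (p\<^sup>2) N * qpoch (r * x) (p\<^sup>2) N" for x
    by (simp add: qpoch_add r_def)
  have three: "qpoch x (p\<^sup>2) (N + N + N) =
      qpoch x (p\<^sup>2) N * qpoch (r * x) (p\<^sup>2) N * qpoch (r * (r * x)) (p\<^sup>2) N" for x
    by (simp add: qpoch_add r_def power_add mult_ac)
  have "qpoch (b * c * p) (p\<^sup>2) (N + N) * qpoch (b * e * p) (p\<^sup>2) (N + N) *
      qpoch (c * e * p) (p\<^sup>2) (N + N) * quad_sum p b c e =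
      (qpoch (r * (b * c * p)) (p\<^sup>2) N * qpoch (c * e * p) (p\<^sup>2) N) *
      (qpoch (r * (b * e * p)) (p\<^sup>2) N * qpoch (r * (c * e * p)) (p\<^sup>2) N) *
      (qpoch (b * c * p) (p\<^sup>2) N * qpoch (b * e * p) (p\<^sup>2) N * quad_sum p b c e)"
    unfolding two by (simp only: mult_ac)
  also have "\<dots> = qpoch (b * p) (p\<^sup>2) N * qpoch (b * c * e / p) (p\<^sup>2) N *
      (qpoch (r * (b * e * p)) (p\<^sup>2) N * qpoch (r * (c * e * p)) (p\<^sup>2) N) *
      (qpoch (r * (b * c * p)) (p\<^sup>2) N * qpoch (c * e * p) (p\<^sup>2) N * quad_sum p (r * b) c e)"
    unfolding A by (simp only: mult_ac)
  also have "\<dots> = qpoch (b * p) (p\<^sup>2) N * qpoch (b * c * e / p) (p\<^sup>2) N *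
      (qpoch (c * p) (p\<^sup>2) N * qpoch (r * (b * c * e / p)) (p\<^sup>2) N) *
      (qpoch (r * (b * e * p)) (p\<^sup>2) N * qpoch (r * (c * e * p)) (p\<^sup>2) N *
      quad_sum p (r * b) (r * c) e)"
    unfolding B by (simp only: mult_ac)
  also have "\<dots> = qpoch (b * p) (p\<^sup>2) N * qpoch (c * p) (p\<^sup>2) N * qpoch (e * p) (p\<^sup>2) N *
      qpoch (b * c * e / p) (p\<^sup>2) (N + N + N) * quad_sum p (r * b) (r * c) (r * e)"
    unfolding C three by (simp only: mult_ac)
  finally show ?thesis .
qed

text \<open>Tannery's theorem: the summands converge termwise, and \<open>WZ_F_bound\<close> at n =
  0 gives a majorant that is the same for all N.\<close>

lemma quad_sum_tendsto: "(\<lambda>N. quad_sum p ((p\<^sup>2) ^ N * b) ((p\<^sup>2) ^ N * c) ((p\<^sup>2) ^ N * e)) \<longlonglongrightarrow> quad_sum p 0 0 0"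
proof -
  define r where "r N = (p\<^sup>2) ^ N" for N :: nat
  have r0: "(\<lambda>N. r N * x) \<longlonglongrightarrow> 0" for x
  proof -
    have "(\<lambda>N. r N * x) \<longlonglongrightarrow> 0 * x"
      unfolding r_def using p by (intro tendsto_intros LIMSEQ_power_zero) (auto simp: power_less_one_iff)
    then show ?thesis by simp
  qed
  have qp: "(\<lambda>N. qpoch (x N) s k) \<longlonglongrightarrow> qpoch 0 s k" if "x \<longlonglongrightarrow> 0" for x s k
    unfolding qpoch_def by (intro tendsto_intros that)
  have params: "quad_params p (r N * b) (r N * c) (r N * e)" for N
    unfolding r_def using p by (intro quad_params_scale) (auto simp: power_le_one)
  have lim: "(\<lambda>N. WZ_F p (r N * b) (r N * c) (r N * e) 0 k) \<longlonglongrightarrow> WZ_F p 0 0 0 0 k" for k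
  proof -
    have prods: "(\<lambda>N. r N * b * (r N * c) * p) \<longlonglongrightarrow> 0" "(\<lambda>N. r N * b * (r N * e) * p) \<longlonglongrightarrow> 0"
      "(\<lambda>N. r N * c * (r N * e) * p) \<longlonglongrightarrow> 0" "(\<lambda>N. r N * b * (r N * c) * (r N * e) / p) \<longlonglongrightarrow> 0"
      by (intro tendsto_mult_zero tendsto_mult_left_zero tendsto_divide_zero r0)+
    have "(\<lambda>N. WZ_F p (r N * b) (r N * c) (r N * e) 0 k) \<longlonglongrightarrow>
        (1 - 0 * p ^ (3 * (0 + k))) * ((-1) ^ 0 * p ^ (3 * (\<Sum>i<0. i)) * 1 *
        qpoch 0 (p\<^sup>2) k * p ^ (3 * 0 * k + (\<Sum>i\<le>k. i)) * (qpoch 0 p (0 + k) * qpoch 0 p (0 + k) * qpoch 0 p (0 + k)) /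
        (qpoch 0 (p\<^sup>2) (0 + k) * qpoch 0 (p\<^sup>2) (0 + k) * qpoch 0 (p\<^sup>2) (0 + k))) / qpoch p p (3 * 0 + k)"
      unfolding WZ_F_def kern_def lessThan_0 prod.empty
      by (intro tendsto_intros qp r0 prods) (use qpoch_pos[of p p k] p in auto)
    then show ?thesis
      by (simp add: WZ_F_def kern_def)
  qed
  have bound: "norm (WZ_F p (r N * b) (r N * c) (r N * e) 0 k) \<le> p ^ k * (1 / d ^ 4)" for N k
    using quad_params.WZ_F_bound[OF params[of N], of 0 k] by simp
  have ev: "\<forall>\<^sub>F (k, N) in sequentially \<times>\<^sub>F sequentially.
      norm (WZ_F p (r N * b) (r N * c) (r N * e) 0 k) \<le> p ^ k * (1 / d ^ 4)"
    using bound by (intro always_eventually) auto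
  have "summable (\<lambda>k. p ^ k * (1 / d ^ 4))"
    using p by (intro summable_mult2 summable_geometric) auto
  from tannerys_theorem[OF lim ev this] show ?thesis
    by (simp add: quad_sum_def r_def)
qed

lemma quad_sum_eq_confluent:
  "qpoch_inf (b * c * p) (p\<^sup>2) * qpoch_inf (b * e * p) (p\<^sup>2) * qpoch_inf (c * e * p) (p\<^sup>2) * quad_sum p b c e =
   qpoch_inf (b * p) (p\<^sup>2) * qpoch_inf (c * p) (p\<^sup>2) * qpoch_inf (e * p) (p\<^sup>2) *
     qpoch_inf (b * c * e / p) (p\<^sup>2) * quad_sum p 0 0 0"
proof -
  have p2: "\<bar>p\<^sup>2\<bar> < 1" using p by (simp add: power_less_one_iff)
  have filt: "filterlim (\<lambda>N::nat. N + N) at_top sequentially" "filterlim (\<lambda>N::nat. N + N + N) at_top sequentially"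
    by (auto intro!: filterlim_at_top_mono[OF filterlim_ident])
  have q: "(\<lambda>N. qpoch x (p\<^sup>2) (N + N)) \<longlonglongrightarrow> qpoch_inf x (p\<^sup>2)"
    "(\<lambda>N. qpoch x (p\<^sup>2) (N + N + N)) \<longlonglongrightarrow> qpoch_inf x (p\<^sup>2)" for x
    by (rule filterlim_compose[OF qpoch_LIMSEQ[OF p2]], rule filt)+
  show ?thesis
    \<comment> \<open>One sequence has two limits: directly, and after rewriting with
      \<open>quad_sum_shift_all\<close>.\<close>
    by (rule LIMSEQ_unique[of "\<lambda>N. qpoch (b * c * p) (p\<^sup>2) (N + N) * qpoch (b * e * p) (p\<^sup>2) (N + N) *
      qpoch (c * e * p) (p\<^sup>2) (N + N) * quad_sum p b c e"])
      (intro tendsto_intros q, unfold quad_sum_shift_all, intro tendsto_intros q qpoch_LIMSEQ p2 quad_sum_tendsto)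
qed

end

text \<open>This is Euler's \<open>\<Sum> p^(k(k+1)/2) / (p;p)\<^sub>k = 1 / (p;p\<^sup>2)\<^sub>\<infinity>\<close>, read off from the
  case \<open>b = p\<^sup>2\<close>, \<open>c = e = 0\<close>, where the quadratic sum telescopes.\<close>

lemma quad_sum_confluent:
  assumes p: "0 < p" "p < 1"
  shows "qpoch_inf p (p\<^sup>2) * quad_sum p 0 0 0 = 1"
proof -
  have p2: "\<bar>p\<^sup>2\<bar> < 1" using p by (simp add: power_less_one_iff)
  interpret quad_params p "p\<^sup>2" 0 0
    by unfold_locales (use p in \<open>auto simp: power_less_one_iff\<close>)
  \<comment> \<open>(p^2;p)_k / (p;p)_k = (1 - p^(k+1)) / (1 - p), and multiplication by p^(k+1)
    carries one triangular power of p to the next.\<close>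
  define g where "g k = p ^ (\<Sum>i\<le>k. i) / (1 - p)" for k :: nat
  have F: "WZ_F p (p\<^sup>2) 0 0 0 k = g k - g (Suc k)" for k
  proof -
    have "(1 - p) * qpoch (p\<^sup>2) p k = qpoch p p k * (1 - p ^ k * p)"
      using qpoch_shift[of p p k] by (simp add: power2_eq_square)
    moreover have "qpoch p p k > 0" using p by (simp add: qpoch_pos)
    ultimately have "qpoch (p\<^sup>2) p k / qpoch p p k = (1 - p ^ k * p) / (1 - p)"
      using p by (simp add: field_simps)
    then have "WZ_F p (p\<^sup>2) 0 0 0 k = p ^ (\<Sum>i\<le>k. i) * ((1 - p ^ k * p) / (1 - p))"
      by (simp add: WZ_F_def kern_def flip: times_divide_eq_right)
    also have "\<dots> = g k - g (Suc k)"
      by (simp add: g_def power_add diff_divide_distrib right_diff_distrib mult_ac)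
    finally show ?thesis .
  qed
  have "(\<lambda>k. p ^ (\<Sum>i\<le>k. i)) \<longlonglongrightarrow> 0"
  proof (rule tendsto_sandwich[OF _ _ tendsto_const])
    show "(\<lambda>k. p ^ k) \<longlonglongrightarrow> 0" using p by (intro LIMSEQ_power_zero) auto
    have "p ^ (\<Sum>i\<le>k. i) \<le> p ^ k" for k
      using p by (intro power_decreasing) (cases k, auto)
    then show "\<forall>\<^sub>F k in sequentially. p ^ (\<Sum>i\<le>k. i) \<le> p ^ k" by simp
  qed (use p in auto)
  then have "g \<longlonglongrightarrow> 0"
    unfolding g_def by (rule tendsto_divide_zero)
  then have "(\<lambda>k. WZ_F p (p\<^sup>2) 0 0 0 k) sums g 0"
    using telescope_sums'[of g 0] by (simp add: F)
  then have S: "quad_sum p (p\<^sup>2) 0 0 = 1 / (1 - p)"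
    by (simp add: quad_sum_def sums_unique[symmetric] g_def)
  \<comment> \<open>For b = p^2, c = e = 0 the confluent identity contains (p^3;p^2)_inf; the factor
    1 - p completes it to (p;p^2)_inf.\<close>
  have "qpoch_inf p (p\<^sup>2) = (1 - p) * qpoch_inf (p\<^sup>2 * p) (p\<^sup>2)"
    using qpoch_inf_shift[OF p2] by simp
  then have "qpoch_inf p (p\<^sup>2) * quad_sum p 0 0 0 = (1 - p) * (qpoch_inf (p\<^sup>2 * p) (p\<^sup>2) * quad_sum p 0 0 0)"
    by simp
  also have "qpoch_inf (p\<^sup>2 * p) (p\<^sup>2) * quad_sum p 0 0 0 = 1 / (1 - p)"
    using quad_sum_eq_confluent by (simp add: S)
  finally show ?thesis
    using p by simp
qed

theorem quadratic_summation:
  assumes "quad_params p b c e"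
  shows "qpoch_inf p (p\<^sup>2) * qpoch_inf (b * c * p) (p\<^sup>2) * qpoch_inf (b * e * p) (p\<^sup>2) *
      qpoch_inf (c * e * p) (p\<^sup>2) * (\<Sum>k. WZ_F p b c e 0 k) =
    qpoch_inf (b * p) (p\<^sup>2) * qpoch_inf (c * p) (p\<^sup>2) * qpoch_inf (e * p) (p\<^sup>2) *
      qpoch_inf (b * c * e / p) (p\<^sup>2)"
proof -
  interpret quad_params p b c e by fact
  let ?n = "qpoch_inf (b * p) (p\<^sup>2) * qpoch_inf (c * p) (p\<^sup>2) * qpoch_inf (e * p) (p\<^sup>2) *
      qpoch_inf (b * c * e / p) (p\<^sup>2)"
  have "qpoch_inf p (p\<^sup>2) * (qpoch_inf (b * c * p) (p\<^sup>2) * qpoch_inf (b * e * p) (p\<^sup>2) *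
      qpoch_inf (c * e * p) (p\<^sup>2) * quad_sum p b c e) = ?n * (qpoch_inf p (p\<^sup>2) * quad_sum p 0 0 0)"
    unfolding quad_sum_eq_confluent by (simp only: mult_ac)
  then show ?thesis
    unfolding quad_sum_confluent[OF p] by (simp add: quad_sum_def mult_ac)
qed

section \<open>Specialisation to sixth powers\<close>

text \<open>With q = x^6 all fractional powers of q in the identity become integer powers of
  x.\<close>

lemma sixth_power_powr:
  fixes x :: real
  assumes "0 < x" "6 * r = real m"
  shows "(x ^ 6) powr r = x ^ m"
proof -
  have "(x ^ 6) powr r = (x powr 6) powr r"
    using assms by (simp add: powr_numeral)
  also have "\<dots> = x ^ m"
    unfolding powr_powr assms(2) using assms by (simp add: powr_realpow)
  finally show ?thesis .
qed

lemma q_summand_sixth_power: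
  fixes x :: real
  assumes x: "0 < x" "x < 1"
  shows "q_summand (x ^ 6) n = (-1) ^ n *
     (qpoch (x ^ 3) (x ^ 6) n * qpoch (x ^ 10) (x ^ 6) n *
      (qpoch (x ^ 3) (x ^ 3) n * qpoch (x ^ 3) (x ^ 3) n * qpoch (x\<^sup>2) (x ^ 3) n)) /
     (qpoch (x\<^sup>2) (x ^ 6) n * qpoch (x ^ 8) (x ^ 6) n * qpoch (x ^ 9) (x ^ 3) (3 * n)) *
     x ^ (9 * (\<Sum>i<n. i) + 8 * n) * ((1 - x ^ 4) / (1 - x ^ 6)) *
     (x ^ (6 * n + 3) * ((1 + x) / (1 + x ^ (3 * n + 2))) +
      (1 - x ^ (15 * n + 7)) / (1 - x ^ (6 * n + 2)))"
proof -
  \<comment> \<open>The exponent of x is n(9n+7)/2 = 9 (0 + ... + (n-1)) + 8n; the triangular sum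
    avoids a division of naturals.\<close>
  have "2 * (\<Sum>i<n. real i) = real n * (real n - 1)"
    by (induction n) (auto simp: algebra_simps)
  then have ex: "(x ^ 6) powr (real n * (9 * real n + 7) / 12) = x ^ (9 * (\<Sum>i<n. i) + 8 * n)"
    using x by (intro sixth_power_powr) (simp_all add: field_simps)
  have pw: "(x ^ 6) powr (1/2) = x ^ 3" "(x ^ 6) powr (5/3) = x ^ 10" "(x ^ 6) powr (1/3) = x\<^sup>2"
    "(x ^ 6) powr (4/3) = x ^ 8" "(x ^ 6) powr (3/2) = x ^ 9" "(x ^ 6) powr (2/3) = x ^ 4"
    "(x ^ 6) powr (1/6) = x ^ 1"
    "(x ^ 6) powr (real n + 1/2) = x ^ (6 * n + 3)"
    "(x ^ 6) powr (real n / 2 + 1/3) = x ^ (3 * n + 2)"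
    "(x ^ 6) powr (5/2 * real n + 7/6) = x ^ (15 * n + 7)"
    "(x ^ 6) powr (real n + 1/3) = x ^ (6 * n + 2)"
    using x by (intro sixth_power_powr; simp)+
  show ?thesis
    unfolding q_summand_def ex pw by (simp add: qpochs_def mult_ac)
qed

text \<open>Origin of the braces in (i): with N = q^(n/2), the second factor is (1 - x^4 N^2)(1 -
  x^2 N^2) times their content.\<close>

lemma WZ_H_at_target:
  fixes x N :: real
  assumes "x \<noteq> 0"
  shows "WZ_H (x ^ 3) (x ^ 3) (x ^ 3) (x\<^sup>2) N 1 =
    (1 - x ^ 3 * N\<^sup>2) * (N\<^sup>2 * x ^ 3 * (1 + x) * (1 - x\<^sup>2 * N) * (1 - x\<^sup>2 * N\<^sup>2)
      + (1 - x ^ 4 * N\<^sup>2) * (1 - N ^ 5 * x ^ 7))"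
proof -
  have "x ^ 3 * x ^ 3 * x\<^sup>2 / x ^ 3 = x ^ 5"
    using assms by (simp add: power_add[symmetric] field_simps)
  then show ?thesis
    unfolding WZ_H_def by algebra
qed

text \<open>The powers x^3, x^3 and x^2 pulled out of the factors with b, c, e give x^8 for each j,
  hence the 8n in the exponent.\<close>

lemma kern_at_target:
  fixes x :: real
  assumes "0 < x"
  shows "kern (x ^ 3) (x ^ 3) (x ^ 3) (x\<^sup>2) n 0 =
    (-1) ^ n * x ^ (9 * (\<Sum>i<n. i) + 8 * n) *
      ((qpoch (x ^ 3) (x ^ 6) n)\<^sup>2 * qpoch (x ^ 4) (x ^ 6) n) *
      ((qpoch (x ^ 3) (x ^ 3) n)\<^sup>2 * qpoch (x\<^sup>2) (x ^ 3) n) /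
      (qpoch (x ^ 9) (x ^ 6) n * (qpoch (x ^ 8) (x ^ 6) n)\<^sup>2)"
proof -
  have sq: "(x ^ 3)\<^sup>2 = x ^ 6" "x ^ 3 * x ^ 3 * x ^ 3 = x ^ 9" "x ^ 3 * x\<^sup>2 * x ^ 3 = x ^ 8"
    by (simp_all add: power_mult[symmetric] power_add[symmetric])
  have "(\<Prod>j<n. (x ^ 3 - x ^ 6 * ((x ^ 3) ^ j)\<^sup>2) * (x ^ 3 - x ^ 6 * ((x ^ 3) ^ j)\<^sup>2) *
      (x\<^sup>2 - x ^ 6 * ((x ^ 3) ^ j)\<^sup>2)) =
    x ^ (8 * n) * ((qpoch (x ^ 3) (x ^ 6) n)\<^sup>2 * qpoch (x ^ 4) (x ^ 6) n)"
  proof (induction n)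
    case (Suc n)
    have y: "((x ^ 3) ^ n)\<^sup>2 = (x ^ 6) ^ n"
      by (simp add: power_mult[symmetric] mult.commute)
    have f: "x ^ 3 - x ^ 6 * (x ^ 6) ^ n = x ^ 3 * (1 - (x ^ 6) ^ n * x ^ 3)"
      "x\<^sup>2 - x ^ 6 * (x ^ 6) ^ n = x\<^sup>2 * (1 - (x ^ 6) ^ n * x ^ 4)"
      by (simp_all add: algebra_simps flip: power_add)
    have e: "x ^ (8 * Suc n) = x ^ (8 * n) * (x ^ 3 * x ^ 3 * x\<^sup>2)"
      by (simp add: add.commute flip: power_add)
    show ?case
      unfolding prod.lessThan_Suc Suc y f qpoch_Suc e by (simp only: power2_eq_square mult_ac)
  qed simp
  moreover have "(x ^ 3) ^ (3 * (\<Sum>i<n. i)) = x ^ (9 * (\<Sum>i<n. i))"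
    by (simp add: power_mult[symmetric])
  ultimately show ?thesis
    unfolding kern_def sq by (simp add: power_add power2_eq_square mult_ac)
qed

text \<open>The two forms differ by one-step shifts in base x^6: from x^3 to x^9, from x^4 to x^10
  and from x^2 to x^8. The last of these accounts for the factor 1 - x^2.\<close>

lemma q_summand_eq_WZ_G:
  fixes x :: real
  assumes x: "0 < x" "x < 1"
  shows "(1 - x\<^sup>2) * q_summand (x ^ 6) n = WZ_G (x ^ 3) (x ^ 3) (x ^ 3) (x\<^sup>2) n 0"
proof -
  define N where "N = x ^ (3 * n)"
  have N: "0 < N" "N \<le> 1" using x by (simp_all add: N_def power_le_one)
  have N6: "(x ^ 6) ^ n = N\<^sup>2"
    by (simp add: N_def power_mult[symmetric] mult.commute)
  define P2 P3 P4 P8 P9 P10 where "P2 = qpoch (x\<^sup>2) (x ^ 6) n" and "P3 = qpoch (x ^ 3) (x ^ 6) n"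
    and "P4 = qpoch (x ^ 4) (x ^ 6) n" and "P8 = qpoch (x ^ 8) (x ^ 6) n"
    and "P9 = qpoch (x ^ 9) (x ^ 6) n" and "P10 = qpoch (x ^ 10) (x ^ 6) n"
  define Q2 Q3 Q9 where "Q2 = qpoch (x\<^sup>2) (x ^ 3) n" and "Q3 = qpoch (x ^ 3) (x ^ 3) n"
    and "Q9 = qpoch (x ^ 9) (x ^ 3) (3 * n)"
  have lt: "x ^ j < 1" if "j > 0" for j
    using x that by (simp add: power_less_one_iff)
  have pos: "P2 > 0" "P3 > 0" "P8 > 0" "P9 > 0" "Q9 > 0"
    using x lt by (auto simp: P2_def P3_def P8_def P9_def Q9_def intro!: qpoch_pos less_imp_le)
  have shift: "(1 - x ^ j) * qpoch (x ^ (6 + j)) (x ^ 6) n = qpoch (x ^ j) (x ^ 6) n * (1 - N\<^sup>2 * x ^ j)" for j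
    using qpoch_shift[of "x ^ j" "x ^ 6" n] by (simp add: N6 power_add)
  have P9: "(1 - x ^ 3) * P9 = P3 * (1 - x ^ 3 * N\<^sup>2)"
    using shift[of 3] by (simp add: P9_def P3_def mult_ac)
  have P10: "(1 - x ^ 4) * P10 = P4 * (1 - x ^ 4 * N\<^sup>2)"
    using shift[of 4] by (simp add: P10_def P4_def mult_ac)
  have P2: "(1 - x\<^sup>2) * P8 = P2 * (1 - x\<^sup>2 * N\<^sup>2)"
    using shift[of 2] by (simp add: P2_def P8_def mult_ac)
  have Q9: "qpoch (x ^ 3) (x ^ 3) (3 * n + 0 + 2) = (1 - x ^ 3) * (1 - x ^ 6) * Q9"
    using qpoch_add[of "x ^ 3" "x ^ 3" 2 "3 * n"]
    by (simp add: Q9_def numeral_2_eq_2 power_add[symmetric] algebra_simps flip: power_mult)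
  have small: "x ^ j * y < 1" if "j > 0" "0 \<le> y" "y \<le> 1" for j y
  proof -
    have "x ^ j * y \<le> x ^ j * 1"
      using that x by (intro mult_left_mono) auto
    with lt[OF that(1)] show ?thesis by linarith
  qed
  have nz: "1 - x\<^sup>2 > 0" "1 - x ^ 3 > 0" "1 - x ^ 4 > 0" "1 - x ^ 6 > 0" "1 - x\<^sup>2 * N\<^sup>2 > 0"
    "1 - x ^ 3 * N\<^sup>2 > 0" "1 + x\<^sup>2 * N > 0"
    using lt[of 2] lt[of 3] lt[of 4] lt[of 6] small[of 2 "N\<^sup>2"] small[of 3 "N\<^sup>2"] N x
    by (simp_all add: power_le_one add_pos_pos)
  define B where "B = N\<^sup>2 * x ^ 3 * ((1 + x) / (1 + x\<^sup>2 * N)) + (1 - N ^ 5 * x ^ 7) / (1 - x\<^sup>2 * N\<^sup>2)"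
  have HB: "WZ_H (x ^ 3) (x ^ 3) (x ^ 3) (x\<^sup>2) N 1 =
      (1 - x ^ 3 * N\<^sup>2) * ((1 - x ^ 4 * N\<^sup>2) * (1 - x\<^sup>2 * N\<^sup>2) * B)"
  proof -
    have "(1 - x ^ 4 * N\<^sup>2) = (1 - x\<^sup>2 * N) * (1 + x\<^sup>2 * N)"
      by algebra
    then have "(1 - x ^ 4 * N\<^sup>2) * (1 - x\<^sup>2 * N\<^sup>2) * (N\<^sup>2 * x ^ 3 * ((1 + x) / (1 + x\<^sup>2 * N))) =
        N\<^sup>2 * x ^ 3 * (1 + x) * (1 - x\<^sup>2 * N) * (1 - x\<^sup>2 * N\<^sup>2)"
      using nz by simp
    moreover have "(1 - x ^ 4 * N\<^sup>2) * (1 - x\<^sup>2 * N\<^sup>2) * ((1 - N ^ 5 * x ^ 7) / (1 - x\<^sup>2 * N\<^sup>2)) =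
        (1 - x ^ 4 * N\<^sup>2) * (1 - N ^ 5 * x ^ 7)"
      using nz by simp
    ultimately show ?thesis
      using x by (simp only: WZ_H_at_target[OF less_imp_neq[OF x(1), symmetric]] B_def distrib_left)
  qed
  define s w where "s = (-1 :: real) ^ n" and "w = x ^ (9 * (\<Sum>i<n. i) + 8 * n)"
  have B: "x ^ (6 * n + 3) * ((1 + x) / (1 + x ^ (3 * n + 2))) +
      (1 - x ^ (15 * n + 7)) / (1 - x ^ (6 * n + 2)) = B"
  proof -
    have N6': "x ^ (6 * n) = N\<^sup>2" and N15: "x ^ (15 * n) = N ^ 5"
      by (simp_all add: N_def flip: power_mult)
    have "x ^ (6 * n + 3) = N\<^sup>2 * x ^ 3" "x ^ (3 * n + 2) = x\<^sup>2 * N" "x ^ (15 * n + 7) = N ^ 5 * x ^ 7"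
      "x ^ (6 * n + 2) = x\<^sup>2 * N\<^sup>2"
      by (simp_all add: power_add N15 N6' N_def power2_eq_square)
    then show ?thesis by (simp only: B_def)
  qed
  have "(1 - x\<^sup>2) * q_summand (x ^ 6) n =
    (1 - x\<^sup>2) * (s * (P3 * P10 * (Q3 * Q3 * Q2)) / (P2 * P8 * Q9) * w * ((1 - x ^ 4) / (1 - x ^ 6)) * B)"
    unfolding q_summand_sixth_power[OF x] B s_def w_def
    by (simp only: P2_def P3_def P8_def P10_def Q2_def Q3_def Q9_def)
  also have "\<dots> = s * w * P3 * Q3\<^sup>2 * Q2 * B * ((1 - x ^ 4) * P10) * ((1 - x\<^sup>2) / P2) / (P8 * Q9 * (1 - x ^ 6))"
    by (simp add: power2_eq_square mult_ac)
  also have "(1 - x\<^sup>2) / P2 = (1 - x\<^sup>2 * N\<^sup>2) / P8"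
    using P2 pos by (simp add: field_simps)
  also have "s * w * P3 * Q3\<^sup>2 * Q2 * B * ((1 - x ^ 4) * P10) * ((1 - x\<^sup>2 * N\<^sup>2) / P8) / (P8 * Q9 * (1 - x ^ 6)) =
      s * w * Q3\<^sup>2 * Q2 * P4 * ((1 - x ^ 4 * N\<^sup>2) * (1 - x\<^sup>2 * N\<^sup>2) * B) * P3 / (P8\<^sup>2 * Q9 * (1 - x ^ 6))"
    unfolding P10 by (simp add: power2_eq_square mult_ac)
  \<comment> \<open>\<open>kern\<close> contains P3^2 / P9 where the summand has P3. So P3 is
    expressed through P9 here, and restored inside the square afterwards.\<close>
  also have "P3 = (1 - x ^ 3) * P9 / (1 - x ^ 3 * N\<^sup>2)"
    using P9 nz by (simp add: field_simps)
  also have "s * w * Q3\<^sup>2 * Q2 * P4 * ((1 - x ^ 4 * N\<^sup>2) * (1 - x\<^sup>2 * N\<^sup>2) * B) * ((1 - x ^ 3) * P9 / (1 - x ^ 3 * N\<^sup>2))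
      / (P8\<^sup>2 * Q9 * (1 - x ^ 6)) =
     WZ_H (x ^ 3) (x ^ 3) (x ^ 3) (x\<^sup>2) N 1 *
      (s * w * (((1 - x ^ 3) * P9 / (1 - x ^ 3 * N\<^sup>2))\<^sup>2 * P4) * (Q3\<^sup>2 * Q2) / (P9 * P8\<^sup>2)) /
      ((1 - x ^ 3) * (1 - x ^ 6) * Q9)"
  proof -
    have "1 - x ^ 3 \<noteq> 0" "1 - x ^ 6 \<noteq> 0" "1 - x ^ 3 * N\<^sup>2 \<noteq> 0" "P9 \<noteq> 0" "P8 \<noteq> 0" "Q9 \<noteq> 0"
      using nz pos by auto
    then show ?thesis
      unfolding HB by (simp add: power2_eq_square) (simp add: mult_ac)
  qed
  also have "(1 - x ^ 3) * P9 / (1 - x ^ 3 * N\<^sup>2) = P3"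
    using P9 nz by (simp add: field_simps)
  also have "WZ_H (x ^ 3) (x ^ 3) (x ^ 3) (x\<^sup>2) N 1 * (s * w * (P3\<^sup>2 * P4) * (Q3\<^sup>2 * Q2) / (P9 * P8\<^sup>2)) /
      ((1 - x ^ 3) * (1 - x ^ 6) * Q9) = WZ_G (x ^ 3) (x ^ 3) (x ^ 3) (x\<^sup>2) n 0"
    unfolding WZ_G_def kern_at_target[OF x(1)] Q9 s_def w_def P3_def P4_def P8_def P9_def Q2_def Q3_def N_def
    by (simp add: power_mult)
  finally show ?thesis .
qed

section \<open>The q-identity\<close>

lemma q_product_sixth_power:
  fixes x :: real
  assumes x: "0 < x" "x < 1"
  shows "q_product (x ^ 6) =
     (qpoch_inf (x ^ 6) (x ^ 6))\<^sup>2 * (qpoch_inf (x ^ 5) (x ^ 6))\<^sup>2 /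
     (qpoch_inf (x ^ 3) (x ^ 6) * qpoch_inf (x ^ 9) (x ^ 6) *
      qpoch_inf (x\<^sup>2) (x ^ 6) * qpoch_inf (x ^ 8) (x ^ 6))"
proof -
  have pw: "(x ^ 6) powr (1/2) = x ^ 3" "(x ^ 6) powr (5/6) = x ^ 5" "(x ^ 6) powr (1/3) = x\<^sup>2"
    "(x ^ 6) powr (4/3) = x ^ 8" "(x ^ 6) powr (3/2) = x ^ 9"
    using x by (intro sixth_power_powr; simp)+
  show ?thesis unfolding q_product_def pw ..
qed

text \<open>Here a = x^5. The factor 1 - x^2 relating summand and \<open>WZ_G\<close> also turns one
  of the two (x^8;x^6)_inf in the quadratic summation into (x^2;x^6)_inf, so it cancels.\<close>

lemma q_summand_sums_sixth_power:
  fixes x :: real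
  assumes x: "0 < x" "x < 1"
  shows "q_summand (x ^ 6) sums q_product (x ^ 6)"
proof -
  have lt: "x ^ j < 1" if "j > 0" for j
    using x that by (simp add: power_less_one_iff)
  interpret quad_params "x ^ 3" "x ^ 3" "x ^ 3" "x\<^sup>2"
  proof
    show "x ^ 3 * x ^ 3 * x\<^sup>2 \<le> x ^ 3"
      unfolding power_add[symmetric] using x by (intro power_decreasing) auto
  qed (use x lt in auto)
  have nz: "qpoch_inf (x ^ j) (x ^ 6) \<noteq> 0" if "j > 0" for j
    using x lt that by (intro qpoch_inf_nonzero) auto
  have "x ^ 3 * x ^ 3 * x\<^sup>2 / x ^ 3 = x ^ 5" "(x ^ 3)\<^sup>2 = x ^ 6" "x ^ 3 * x ^ 3 * x ^ 3 = x ^ 9"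
    "x ^ 3 * x\<^sup>2 * x ^ 3 = x ^ 8" "x ^ 3 * x ^ 3 = x ^ 6" "x\<^sup>2 * x ^ 3 = x ^ 5"
    using x by (simp_all add: field_simps flip: power_mult power_add)
  then have S: "qpoch_inf (x ^ 3) (x ^ 6) * qpoch_inf (x ^ 9) (x ^ 6) * qpoch_inf (x ^ 8) (x ^ 6) *
      qpoch_inf (x ^ 8) (x ^ 6) * (\<Sum>k. WZ_F (x ^ 3) (x ^ 3) (x ^ 3) (x\<^sup>2) 0 k) =
    qpoch_inf (x ^ 6) (x ^ 6) * qpoch_inf (x ^ 6) (x ^ 6) * qpoch_inf (x ^ 5) (x ^ 6) * qpoch_inf (x ^ 5) (x ^ 6)"
    using quadratic_summation[OF quad_params_axioms] by (simp only:)
  have x2: "x\<^sup>2 < 1" using lt[of 2] by simp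
  have "\<bar>x ^ 6\<bar> < 1" using x lt[of 6] by simp
  from qpoch_inf_shift[OF this, of "x\<^sup>2"]
  have P2: "qpoch_inf (x\<^sup>2) (x ^ 6) = (1 - x\<^sup>2) * qpoch_inf (x ^ 8) (x ^ 6)"
    by (simp flip: power_add)
  have "(1 - x\<^sup>2) * q_product (x ^ 6) = (\<Sum>k. WZ_F (x ^ 3) (x ^ 3) (x ^ 3) (x\<^sup>2) 0 k)"
    unfolding q_product_sixth_power[OF x] P2
    using S nz[of 3] nz[of 9] nz[of 8] x2 by (simp add: divide_simps power2_eq_square mult_ac)
  moreover have "(\<lambda>n. (1 - x\<^sup>2) * q_summand (x ^ 6) n) sums (\<Sum>k. WZ_F (x ^ 3) (x ^ 3) (x ^ 3) (x\<^sup>2) 0 k)"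
    unfolding q_summand_eq_WZ_G[OF x] by (rule WZ_G_sums)
  ultimately show ?thesis
    using x2 by (simp add: sums_mult_iff flip: \<open>(1 - x\<^sup>2) * q_product (x ^ 6) = _\<close>)
qed

lemma q_summand_sums:
  assumes "0 < q" "q < 1"
  shows "q_summand q sums q_product q"
  using q_summand_sums_sixth_power[of "root 6 q"] assms by simp

section \<open>The limit of the series\<close>

text \<open>Bernoulli's inequality; it bounds (1 - x^i) / (1 - x^j) independently of x, also near x
  = 1.\<close>

lemma one_minus_power_le:
  fixes x :: real
  assumes "0 \<le> x" "x \<le> 1" "i \<le> k * j"
  shows "1 - x ^ i \<le> real k * (1 - x ^ j)"
proof -
  have "1 + real k * (x ^ j - 1) \<le> (1 + (x ^ j - 1)) ^ k"
    using assms by (intro Bernoulli_inequality) (auto simp: power_le_one)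
  moreover have "x ^ (k * j) \<le> x ^ i"
    using assms by (intro power_decreasing) auto
  ultimately show ?thesis
    by (simp add: power_mult[symmetric] mult.commute algebra_simps)
qed

text \<open>The difference of the sides is (1 - y)^3 / 3. The extra factor y, taken from the power
  of q, brings (1 - y) / (1 - y^3) below its limit 1/3 on all of [0,1).\<close>

lemma one_minus_mult_le_cube:
  fixes y :: real
  assumes "0 \<le> y" "y \<le> 1"
  shows "(1 - y) * y \<le> 1/3 * (1 - y ^ 3)"
proof -
  have "1/3 * (1 - y ^ 3) - (1 - y) * y = 1/3 * ((1 - y) * (1 - y)\<^sup>2)"
    by algebra
  also have "\<dots> \<ge> 0"
    using assms by simp
  finally show ?thesis by simp
qed

definition q_coeff :: "real \<Rightarrow> nat \<Rightarrow> real" where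
  "q_coeff x n =
     (qpoch (x ^ 3) (x ^ 6) n * qpoch (x ^ 10) (x ^ 6) n *
      (qpoch (x ^ 3) (x ^ 3) n * qpoch (x ^ 3) (x ^ 3) n * qpoch (x\<^sup>2) (x ^ 3) n)) /
     (qpoch (x\<^sup>2) (x ^ 6) n * qpoch (x ^ 8) (x ^ 6) n * qpoch (x ^ 9) (x ^ 3) (3 * n)) *
     x ^ (9 * (\<Sum>i<n. i) + 8 * n)"

text \<open>The ratio of consecutive coefficients splits into five quotients bounded by 1, 5, 1/3,
  1/3, 1 for every x. Their product 5/9 is far from the limiting 1/27, but any rate below 1
  suffices.\<close>

lemma q_coeff_bound:
  assumes x: "0 < x" "x < 1"
  shows "0 \<le> q_coeff x n \<and> q_coeff x n \<le> (5/9) ^ n"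
proof (induction n)
  case 0
  show ?case by (simp add: q_coeff_def)
next
  case (Suc n)
  define u where "u j = 1 - x ^ j" for j
  have u: "u j > 0" if "j > 0" for j
    using x that by (simp add: u_def power_less_one_iff)
  have u0: "0 \<le> u j" for j
    using x by (simp add: u_def power_le_one)
  \<comment> \<open>The power x^(9n+8) gained in one step is distributed as (3n+3) + (3n+4) + (3n+1)
    over the last three quotients.\<close>
  define r1 r2 r3 r4 r5 where "r1 = u (6 * n + 3) / u (6 * n + 8)"
    and "r2 = u (6 * n + 10) / u (6 * n + 2)"
    and "r3 = u (3 * n + 3) * x ^ (3 * n + 3) / u (9 * n + 9)"
    and "r4 = u (3 * n + 3) * x ^ (3 * n + 4) / u (9 * n + 12)"
    and "r5 = u (3 * n + 2) * x ^ (3 * n + 1) / u (9 * n + 15)"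
  have qs: "qpoch (x ^ a) (x ^ b) (Suc k) = qpoch (x ^ a) (x ^ b) k * u (b * k + a)" for a b k
    by (simp add: u_def power_add power_mult)
  have q3: "qpoch (x ^ 9) (x ^ 3) (3 * Suc n) = qpoch (x ^ 9) (x ^ 3) (3 * n) *
      (u (9 * n + 9) * u (9 * n + 12) * u (9 * n + 15))"
  proof -
    have "3 * Suc n = Suc (Suc (Suc (3 * n)))" by simp
    then show ?thesis
      by (simp only: qs) (simp add: ac_simps)
  qed
  have ex: "x ^ (9 * (\<Sum>i<Suc n. i) + 8 * Suc n) =
      x ^ (9 * (\<Sum>i<n. i) + 8 * n) * (x ^ (3 * n + 3) * x ^ (3 * n + 4) * x ^ (3 * n + 1))"
    unfolding power_add[symmetric] by (rule arg_cong[where f = "power x"]) simp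
  have step: "q_coeff x (Suc n) = q_coeff x n * (r1 * r2 * r3 * r4 * r5)"
    unfolding q_coeff_def qs q3 ex r1_def r2_def r3_def r4_def r5_def by (simp add: mult_ac)
  have r0: "0 \<le> r1" "0 \<le> r2" "0 \<le> r3" "0 \<le> r4" "0 \<le> r5"
    using x u0 by (simp_all add: r1_def r2_def r3_def r4_def r5_def)
  have mono: "u i \<le> u j" if "i \<le> j" for i j
    using x that by (simp add: u_def power_decreasing)
  have cube: "u i * x ^ i \<le> 1/3 * u (3 * i)" for i
    using one_minus_mult_le_cube[of "x ^ i"] x
    by (simp add: u_def power_le_one mult.commute[of 3] flip: power_mult)
  have r1: "r1 \<le> 1"
    unfolding r1_def using u[of "6 * n + 8"] mono[of "6 * n + 3" "6 * n + 8"] by simp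
  \<comment> \<open>The case n = 0 forces the constant, since 10 = 5 * 2.\<close>
  have r2: "r2 \<le> 5"
    unfolding r2_def using u[of "6 * n + 2"] one_minus_power_le[of x "6 * n + 10" 5 "6 * n + 2"] x
    by (simp add: u_def divide_simps)
  have r3: "r3 \<le> 1/3"
    unfolding r3_def using u[of "9 * n + 9"] cube[of "3 * n + 3"] by (simp add: divide_simps)
  have r4: "r4 \<le> 1/3"
  proof -
    have "u (3 * n + 3) * x ^ (3 * n + 4) \<le> u (3 * n + 4) * x ^ (3 * n + 4)"
      using x by (intro mult_right_mono mono) auto
    also have "\<dots> \<le> 1/3 * u (9 * n + 12)"
      using cube[of "3 * n + 4"] by simp
    finally show ?thesis
      unfolding r4_def using u[of "9 * n + 12"] by (simp add: divide_simps)
  qed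
  have r5: "r5 \<le> 1"
  proof -
    have "u (3 * n + 2) * x ^ (3 * n + 1) \<le> u (9 * n + 15) * 1"
      using x u0 by (intro mult_mono mono power_le_one) auto
    then show ?thesis
      unfolding r5_def using u[of "9 * n + 15"] by simp
  qed
  have "r1 * r2 * r3 * r4 * r5 \<le> 1 * 5 * (1/3) * (1/3) * 1"
    by (intro mult_mono r1 r2 r3 r4 r5 r0 mult_nonneg_nonneg) auto
  then have "q_coeff x n * (r1 * r2 * r3 * r4 * r5) \<le> (5/9) ^ n * (5/9)"
    using Suc r0 by (intro mult_mono) auto
  then show ?case
    using Suc r0 unfolding step by (simp add: mult.commute)
qed

text \<open>The constant is 6 = 2 + 4: the first term in the braces is at most 2, and 15n + 7 <= 4
  (6n + 2) bounds the second by 4.\<close>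

lemma q_summand_bound:
  assumes "0 < q" "q < 1"
  shows "\<bar>q_summand q n\<bar> \<le> 6 * (5/9) ^ n"
proof -
  define x where "x = root 6 q"
  have x: "0 < x" "x < 1" and q: "q = x ^ 6"
    using assms by (simp_all add: x_def)
  define B where "B = x ^ (6 * n + 3) * ((1 + x) / (1 + x ^ (3 * n + 2))) +
      (1 - x ^ (15 * n + 7)) / (1 - x ^ (6 * n + 2))"
  define w where "w = (1 - x ^ 4) / (1 - x ^ 6)"
  have lt: "x ^ j < 1" if "j > 0" for j
    using x that by (simp add: power_less_one_iff)
  have "0 \<le> x ^ (6 * n + 3) * ((1 + x) / (1 + x ^ (3 * n + 2)))"
    using x by simp
  moreover have "x ^ (6 * n + 3) * ((1 + x) / (1 + x ^ (3 * n + 2))) \<le> 1 * (2 / 1)"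
    using x by (intro mult_mono frac_le power_le_one) auto
  moreover have "0 \<le> (1 - x ^ (15 * n + 7)) / (1 - x ^ (6 * n + 2))"
    using lt[of "15 * n + 7"] lt[of "6 * n + 2"] by simp
  moreover have "(1 - x ^ (15 * n + 7)) / (1 - x ^ (6 * n + 2)) \<le> 4"
    using one_minus_power_le[of x "15 * n + 7" 4 "6 * n + 2"] lt[of "6 * n + 2"] x
    by (simp add: divide_simps)
  ultimately have B: "0 \<le> B" "B \<le> 6"
    by (simp_all add: B_def)
  have "x ^ 6 \<le> x ^ 4"
    using x by (intro power_decreasing) auto
  then have w: "0 \<le> w" "w \<le> 1"
    using lt[of 4] lt[of 6] by (simp_all add: w_def)
  have "s * a / d * X * y * z = s * (a / d * X) * y * z" for s a d X y z :: real
    by simp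
  then have "q_summand q n = (-1) ^ n * q_coeff x n * w * B"
    unfolding q q_summand_sixth_power[OF x] q_coeff_def B_def w_def .
  then have "\<bar>q_summand q n\<bar> = q_coeff x n * w * B"
    using B w q_coeff_bound[OF x, of n] by (simp add: abs_mult)
  also have "\<dots> \<le> (5/9) ^ n * 1 * 6"
    using q_coeff_bound[OF x, of n] B w by (intro mult_mono) auto
  finally show ?thesis by (simp add: mult.commute)
qed

section \<open>Termwise limits of the summand\<close>

lemma power_quotient_tendsto:
  "((\<lambda>x::real. (1 - x ^ m) / (1 - x)) \<longlongrightarrow> real m) (at_left 1)"
proof -
  have "((\<lambda>x::real. \<Sum>i<m. x ^ i) \<longlongrightarrow> (\<Sum>i<m. 1 ^ i)) (at_left 1)"
    by (intro tendsto_intros)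
  then have "((\<lambda>x::real. \<Sum>i<m. x ^ i) \<longlongrightarrow> real m) (at_left 1)"
    by simp
  moreover have "\<forall>\<^sub>F x::real in at_left 1. (\<Sum>i<m. x ^ i) = (1 - x ^ m) / (1 - x)"
    unfolding eventually_at_filter by (rule always_eventually) (auto simp: one_diff_power_eq)
  ultimately show ?thesis
    by (rule Lim_transform_eventually)
qed

lemma qpoch_quotient_tendsto:
  "((\<lambda>x. qpoch (x ^ a) (x ^ b) n / (1 - x) ^ n) \<longlongrightarrow> (\<Prod>j<n. real (b * j + a))) (at_left 1)"
proof -
  have "((\<lambda>x::real. \<Prod>j<n. (1 - x ^ (b * j + a)) / (1 - x)) \<longlongrightarrow> (\<Prod>j<n. real (b * j + a))) (at_left 1)"
    by (intro tendsto_prod power_quotient_tendsto)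
  then show ?thesis
    by (simp add: qpoch_def prod_dividef power_add power_mult)
qed

lemma prod_arith_eq_pochhammer:
  assumes "b > 0"
  shows "(\<Prod>j<n. real (b * j + a)) = real b ^ n * pochhammer (real a / real b) n"
  using assms by (induction n) (auto simp: pochhammer_Suc field_simps)

text \<open>Triplication of the shifted factorial (3)_(3n), which is the limit of (x^9;x^3)_(3n) up
  to powers of 3 and 1 - x. It is the source of 27^n in (ii).\<close>

lemma pochhammer_three_triple:
  "pochhammer (3::real) (3 * n) = 27 ^ n * (pochhammer 1 n * pochhammer (4/3) n * pochhammer (5/3) n)"
proof (induction n)
  case (Suc n)
  have "3 * Suc n = Suc (Suc (Suc (3 * n)))" by simp
  then have "pochhammer (3::real) (3 * Suc n) =
      pochhammer 3 (3 * n) * ((3 + real (3 * n)) * (3 + real (Suc (3 * n))) * (3 + real (Suc (Suc (3 * n)))))"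
    by (simp only: pochhammer_Suc mult.assoc)
  also have "(3 + real (3 * n)) * (3 + real (Suc (3 * n))) * (3 + real (Suc (Suc (3 * n)))) =
      27 * ((1 + real n) * (4/3 + real n) * (5/3 + real n))"
    by (simp add: field_simps)
  finally show ?case
    unfolding Suc pochhammer_Suc by simp
qed simp

text \<open>Puts the limit in the shape in which it arises: every 1 - x^m in
  \<open>q_summand_sixth_power\<close> is replaced by m.\<close>

lemma limit_summand_eq:
  defines "l a b n \<equiv> (\<Prod>j<n. real (b * j + a))"
  shows "limit_summand n = (-1) ^ n *
     (l 3 6 n * l 10 6 n * (l 3 3 n * l 3 3 n * l 2 3 n)) / (l 2 6 n * l 8 6 n * l 9 3 (3 * n)) *
     1 * (4 / 6) * (1 * ((1 + 1) / (1 + 1)) + real (15 * n + 7) / real (6 * n + 2))"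
proof -
  have l: "l a b n = real b ^ n * pochhammer (real a / real b) n" if "b > 0" for a b n
    unfolding l_def using that by (rule prod_arith_eq_pochhammer)
  have nz: "pochhammer y n \<noteq> 0" if "y > 0" for y :: real
    using pochhammer_pos[OF that, of n] by simp
  \<comment> \<open>Absorbs both (1/3)_n and the denominator 3n + 1 of the braces, which produces
    the cube of (4/3)_n.\<close>
  have p43: "pochhammer (4/3) n = pochhammer (1/3) n * (3 * real n + 1)"
    by (induction n) (auto simp: pochhammer_Suc field_simps)
  have B: "1 * ((1 + 1) / (1 + 1)) + real (15 * n + 7) / real (6 * n + 2) = 3 * (3 + 7 * real n) / (2 * (3 * real n + 1))"
    by (simp add: field_simps)
  have pw: "(- (1 / 27) :: real) ^ n * 27 ^ n = (-1) ^ n"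
    by (simp flip: power_mult_distrib)
  have p27: "(3::real) ^ (3 * n) = 27 ^ n" "(27::real) ^ n = 3 ^ n * 3 ^ n * 3 ^ n"
    by (simp_all add: power_mult flip: power_mult_distrib)
  have "(-1) ^ n *
     (l 3 6 n * l 10 6 n * (l 3 3 n * l 3 3 n * l 2 3 n)) / (l 2 6 n * l 8 6 n * l 9 3 (3 * n)) *
     1 * (4 / 6) * (3 * (3 + 7 * real n) / (2 * (3 * real n + 1))) =
    (-1) ^ n * (pochhammer (1/2) n * pochhammer (5/3) n * (pochhammer 1 n * pochhammer 1 n * pochhammer (2/3) n)) /
    (pochhammer (1/3) n * pochhammer (4/3) n * (27 ^ n * (pochhammer 1 n * pochhammer (4/3) n * pochhammer (5/3) n))) *
      ((3 + 7 * real n) / (3 * real n + 1))"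
    by (simp add: l p27(1) pochhammer_three_triple) (simp add: p27 divide_simps, simp add: algebra_simps)
  also have "\<dots> = limit_summand n"
    using nz[of 1] nz[of "5/3"] nz[of "4/3"] nz[of "1/3"]
    by (simp add: limit_summand_def pw p43 power3_eq_cube divide_simps)
  finally show ?thesis
    unfolding B ..
qed

lemma root_6_filterlim: "filterlim (root 6) (at_left 1) (at_left 1)"
proof -
  have "(root 6 \<longlongrightarrow> root 6 1) (at_left 1)"
    by (intro tendsto_intros)
  moreover have "\<forall>\<^sub>F q in at_left (1::real). root 6 q \<in> {..<1} \<and> root 6 q \<noteq> 1"
    unfolding eventually_at_filter by (rule always_eventually) auto
  ultimately show ?thesis
    by (simp add: filterlim_at)
qed

lemma at_left_1_sixth_power:
  assumes "((\<lambda>x. f (x ^ 6)) \<longlongrightarrow> l) (at_left 1)"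
  shows "(f \<longlongrightarrow> (l :: real)) (at_left (1 :: real))"
proof (rule Lim_transform_eventually)
  show "((\<lambda>q. f (root 6 q ^ 6)) \<longlongrightarrow> l) (at_left 1)"
    by (rule filterlim_compose[OF assms root_6_filterlim])
  show "\<forall>\<^sub>F q in at_left 1. f (root 6 q ^ 6) = f q"
    using eventually_at_left_real[of 0 1] by (auto elim!: eventually_mono)
qed

text \<open>The shifted factorials contribute 5n factors 1 - x^m above and 5n below, so each can be
  divided by 1 - x without changing the summand.\<close>

lemma q_summand_tendsto: "((\<lambda>q. q_summand q n) \<longlongrightarrow> limit_summand n) (at_left 1)"
proof (rule at_left_1_sixth_power, rule Lim_transform_eventually)
  define Q where "Q a b n x = qpoch (x ^ a) (x ^ b) n / (1 - x) ^ n" for a b n and x :: real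
  define u where "u m x = (1 - x ^ m) / (1 - x)" for m and x :: real
  show "((\<lambda>x. (-1) ^ n *
     (Q 3 6 n x * Q 10 6 n x * (Q 3 3 n x * Q 3 3 n x * Q 2 3 n x)) / (Q 2 6 n x * Q 8 6 n x * Q 9 3 (3 * n) x) *
     x ^ (9 * (\<Sum>i<n. i) + 8 * n) * (u 4 x / u 6 x) *
     (x ^ (6 * n + 3) * ((1 + x) / (1 + x ^ (3 * n + 2))) + u (15 * n + 7) x / u (6 * n + 2) x))
     \<longlongrightarrow> limit_summand n) (at_left 1)"
  proof -
    have nz: "(\<Prod>j<k. real (b * j + a)) \<noteq> 0" if "a > 0" for a b k
      using that by (simp del: of_nat_add of_nat_mult)
    have Q: "(Q a b k \<longlongrightarrow> (\<Prod>j<k. real (b * j + a))) (at_left 1)" for a b k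
      unfolding Q_def by (rule qpoch_quotient_tendsto)
    have u: "(u m \<longlongrightarrow> real m) (at_left 1)" for m
      unfolding u_def by (rule power_quotient_tendsto)
    have x: "((\<lambda>x::real. x ^ m) \<longlongrightarrow> 1) (at_left 1)" for m
      using tendsto_power[OF tendsto_ident_at[of "1 :: real" "{..<1}"], of m] by simp
    show ?thesis
      unfolding limit_summand_eq
      by (intro tendsto_intros Q u x u[of 4, simplified] u[of 6, simplified]) (use nz in \<open>auto simp del: of_nat_add of_nat_mult\<close>)
  qed
  have "\<forall>\<^sub>F x in at_left 1. x \<in> {0<..<1::real}"
    by (rule eventually_at_left_real) simp
  then show "\<forall>\<^sub>F x in at_left 1. (-1) ^ n *
     (Q 3 6 n x * Q 10 6 n x * (Q 3 3 n x * Q 3 3 n x * Q 2 3 n x)) / (Q 2 6 n x * Q 8 6 n x * Q 9 3 (3 * n) x) *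
     x ^ (9 * (\<Sum>i<n. i) + 8 * n) * (u 4 x / u 6 x) *
     (x ^ (6 * n + 3) * ((1 + x) / (1 + x ^ (3 * n + 2))) + u (15 * n + 7) x / u (6 * n + 2) x) =
     q_summand (x ^ 6) n"
  proof eventually_elim
    case (elim x)
    then have x: "0 < x" "x < 1" by auto
    define y where "y = (1 - x) ^ n"
    have y: "y > 0" "(1 - x) ^ (3 * n) = y * y * y"
      using x by (simp_all add: y_def power_mult power3_eq_cube flip: power_mult_distrib)
    show ?case
      unfolding q_summand_sixth_power[OF x] Q_def u_def y(2) y_def[symmetric]
      using x y by simp
  qed
qed

text \<open>Tannery's theorem with the majorant 6 (5/9)^n, which also gives the convergence of the
  limit series.\<close>

lemma suminf_q_summand_tendsto:
  "((\<lambda>q. \<Sum>n. q_summand q n) \<longlongrightarrow> (\<Sum>n. limit_summand n)) (at_left 1)"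
  and summable_limit_summand: "summable limit_summand"
proof -
  have "\<forall>\<^sub>F q in at_left 1. q \<in> {0<..<1::real}"
    by (rule eventually_at_left_real) simp
  then have "\<forall>\<^sub>F (n, q) in sequentially \<times>\<^sub>F at_left 1. norm (q_summand q n) \<le> 6 * (5/9) ^ n"
    unfolding eventually_prod_filter
    using q_summand_bound by (intro exI[of _ "\<lambda>_. True"] exI[of _ "\<lambda>q. q \<in> {0<..<1}"]) auto
  moreover have "summable (\<lambda>n. 6 * (5/9 :: real) ^ n)"
    by (intro summable_mult summable_geometric) simp
  ultimately show "((\<lambda>q. \<Sum>n. q_summand q n) \<longlongrightarrow> (\<Sum>n. limit_summand n)) (at_left 1)"
    and "summable limit_summand"
    using tannerys_theorem[of "\<lambda>n q. q_summand q n", OF q_summand_tendsto]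
    by (auto intro: summable_norm_cancel)
qed

section \<open>The limit of the product\<close>

text \<open>Each of the i terms of the geometric sum is at least x^i. The factor x^i lost here is
  supplied by the numerator of \<open>excess\<close>.\<close>

lemma one_minus_power_ge:
  fixes x :: real
  assumes "0 \<le> x" "x \<le> 1"
  shows "real i * (1 - x) * x ^ i \<le> 1 - x ^ i"
proof -
  have "real i * x ^ i = (\<Sum>j<i. x ^ i)"
    by simp
  also have "\<dots> \<le> (\<Sum>j<i. x ^ j)"
    using assms by (intro sum_mono power_decreasing) auto
  finally have "(1 - x) * (real i * x ^ i) \<le> (1 - x) * (\<Sum>j<i. x ^ j)"
    using assms by (intro mult_left_mono) auto
  then show ?thesis
    by (simp add: one_diff_power_eq mult_ac)
qed

text \<open>From \<open>(1 - u h)\<^sup>2 = (1 - u) (1 - u h\<^sup>2) + u (1 - h)\<^sup>2\<close> with \<open>u = x\<^sup>m\<close>, \<open>h = x\<^sup>3\<close>: each factor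
  of the product is a product of two numbers \<open>1 + excess m x\<close>.\<close>

definition excess :: "nat \<Rightarrow> real \<Rightarrow> real" where
  "excess m x = x ^ m * (1 - x ^ 3)\<^sup>2 / ((1 - x ^ m) * (1 - x ^ (m + 6)))"

lemma excess_eq:
  assumes "0 < x" "x < 1" "m > 0"
  shows "1 + excess m x = (1 - x ^ (m + 3))\<^sup>2 / ((1 - x ^ m) * (1 - x ^ (m + 6)))"
proof -
  have "1 - x ^ m > 0" "1 - x ^ (m + 6) > 0"
    using assms by (simp_all add: power_less_one_iff del: power_add)
  moreover have "(1 - x ^ m) * (1 - x ^ (m + 6)) + x ^ m * (1 - x ^ 3)\<^sup>2 = (1 - x ^ (m + 3))\<^sup>2"
    unfolding power_add by algebra
  moreover have "1 + a / D = (D + a) / D" if "D \<noteq> 0" for a D :: real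
    using that by (simp add: add_divide_distrib)
  ultimately show ?thesis
    unfolding excess_def by simp
qed

lemma excess_nonneg:
  assumes "0 < x" "x < 1"
  shows "0 \<le> excess m x"
  using assms unfolding excess_def
  by (intro divide_nonneg_nonneg mult_nonneg_nonneg) (auto simp: power_le_one)

text \<open>The numerator \<open>x\<^sup>m\<close> has to be shared evenly between the two factors of the denominator
  for a bound that is uniform in \<open>x\<close> and summable over \<open>m\<close>.\<close>

lemma excess_bound:
  assumes x: "0 < x" "x < 1" and m: "2 * i \<le> m" "i > 0"
  shows "excess m x \<le> 9 / (real i)\<^sup>2"
proof -
  define y where "y = x ^ i"
  have y: "0 < y" "y < 1"
    using x m by (simp_all add: y_def power_less_one_iff)
  have y2: "y\<^sup>2 = x ^ (2 * i)"
    by (simp add: y_def power_mult[symmetric] mult.commute)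
  have y2': "0 < 1 - y\<^sup>2"
    using y by (simp add: power_less_one_iff)
  have le: "x ^ m \<le> y\<^sup>2" "x ^ (m + 6) \<le> y\<^sup>2"
    unfolding y2 using x m by (intro power_decreasing; simp)+
  have "excess m x \<le> y\<^sup>2 * (1 - x ^ 3)\<^sup>2 / ((1 - y\<^sup>2) * (1 - y\<^sup>2))"
    unfolding excess_def using le y2' x by (intro frac_le mult_mono mult_pos_pos) auto
  also have "\<dots> = ((1 - x ^ 3) * (y / (1 - y\<^sup>2)))\<^sup>2"
    by (simp add: power2_eq_square mult_ac)
  also have "\<dots> \<le> (3 / real i)\<^sup>2"
  proof (rule power_mono)
    have "1 - x ^ 3 \<le> 3 * (1 - x)"
      using one_minus_power_le[of x 3 3 1] x by simp
    moreover have "y / (1 - y\<^sup>2) \<le> 1 / (real i * (1 - x))"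
    proof -
      have "real i * (1 - x) * y \<le> 1 - y"
        unfolding y_def using x by (intro one_minus_power_ge) auto
      also have "\<dots> \<le> 1 - y\<^sup>2"
        using y by (simp add: power2_eq_square)
      finally show ?thesis
        using y2' x m by (simp add: field_simps)
    qed
    ultimately have "(1 - x ^ 3) * (y / (1 - y\<^sup>2)) \<le> 3 * (1 - x) * (1 / (real i * (1 - x)))"
      using x y y2' by (intro mult_mono) auto
    also have "3 * (1 - x) * (1 / (real i * (1 - x))) = 3 / real i"
      using x m by (simp add: field_simps)
    finally show "(1 - x ^ 3) * (y / (1 - y\<^sup>2)) \<le> 3 / real i" .
    show "0 \<le> (1 - x ^ 3) * (y / (1 - y\<^sup>2))"
      using x y y2' by (simp add: power_le_one)
  qed
  finally show ?thesis by (simp add: power_divide)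
qed

text \<open>The index 6j + 3 collects the factors with offsets 3, 6, 9, and 6j + 2 those with
  offsets 2, 5, 8.\<close>

definition prod_factor :: "real \<Rightarrow> nat \<Rightarrow> real" where
  "prod_factor x j = (1 + excess (6 * j + 3) x) * (1 + excess (6 * j + 2) x)"

lemma prod_factor_eq:
  assumes x: "0 < x" "x < 1"
  shows "prod_factor x j = (1 - x ^ (6 * j + 6))\<^sup>2 * (1 - x ^ (6 * j + 5))\<^sup>2 /
     ((1 - x ^ (6 * j + 3)) * (1 - x ^ (6 * j + 9)) * (1 - x ^ (6 * j + 2)) * (1 - x ^ (6 * j + 8)))"
  unfolding prod_factor_def using excess_eq[OF x, of "6 * j + 3"] excess_eq[OF x, of "6 * j + 2"]
  by (simp add: mult_ac add_ac)

lemma prod_factor_ge_1: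
  assumes "0 < x" "x < 1"
  shows "1 \<le> prod_factor x j"
proof -
  have "1 * 1 \<le> prod_factor x j"
    unfolding prod_factor_def using excess_nonneg[OF assms] by (intro mult_mono) auto
  then show ?thesis by simp
qed

text \<open>\<open>excess_bound\<close> applies twice with i = j + 1, since 2(j + 1) <= 6j + 2, and
  ln (1 + E) <= E; this gives 18 = 9 + 9.\<close>

lemma ln_prod_factor_bound:
  assumes x: "0 < x" "x < 1"
  shows "norm (ln (prod_factor x j)) \<le> 18 * (1 / (real (Suc j))\<^sup>2)"
proof -
  define E F where "E = excess (6 * j + 3) x" and "F = excess (6 * j + 2) x"
  have nn: "0 \<le> E" "0 \<le> F"
    using excess_nonneg[OF x] by (simp_all add: E_def F_def)
  have "E \<le> 9 / (real (Suc j))\<^sup>2" "F \<le> 9 / (real (Suc j))\<^sup>2"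
    unfolding E_def F_def using x by (intro excess_bound; simp)+
  moreover have "ln (prod_factor x j) = ln (1 + E) + ln (1 + F)"
    using nn by (simp add: prod_factor_def E_def F_def ln_mult)
  moreover have "ln (1 + E) \<le> E" "ln (1 + F) \<le> F"
    using nn by (simp_all add: ln_add_one_self_le_self)
  moreover have "0 \<le> ln (prod_factor x j)"
    using prod_factor_ge_1[OF x] by (simp add: ln_ge_zero)
  ultimately show ?thesis by simp
qed

lemma ln_prod_factor_sums:
  assumes x: "0 < x" "x < 1"
  shows "(\<lambda>j. ln (prod_factor x j)) sums ln (q_product (x ^ 6))" and "q_product (x ^ 6) > 0"
proof -
  have lt: "x ^ j < 1" if "j > 0" for j
    using x that by (simp add: power_less_one_iff)
  have x6: "\<bar>x ^ 6\<bar> < 1" using x lt[of 6] by simp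
  have pos: "qpoch_inf (x ^ j) (x ^ 6) > 0" if "j > 0" for j
    using x lt that by (intro qpoch_inf_pos) auto
  show qp: "q_product (x ^ 6) > 0"
    unfolding q_product_sixth_power[OF x]
    by (intro divide_pos_pos mult_pos_pos zero_less_power pos) auto
  have "(\<Prod>j<n. prod_factor x j) =
    (qpoch (x ^ 6) (x ^ 6) n)\<^sup>2 * (qpoch (x ^ 5) (x ^ 6) n)\<^sup>2 /
     (qpoch (x ^ 3) (x ^ 6) n * qpoch (x ^ 9) (x ^ 6) n * qpoch (x\<^sup>2) (x ^ 6) n * qpoch (x ^ 8) (x ^ 6) n)" for n
  proof (induction n)
    case (Suc n)
    have e: "(x ^ 6) ^ n * x ^ a = x ^ (6 * n + a)" for a
      by (simp add: power_add power_mult)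
    show ?case
      unfolding prod.lessThan_Suc Suc qpoch_Suc e unfolding prod_factor_eq[OF x]
      by (simp add: power_mult_distrib mult_ac)
  qed simp
  moreover have "(\<lambda>n. (qpoch (x ^ 6) (x ^ 6) n)\<^sup>2 * (qpoch (x ^ 5) (x ^ 6) n)\<^sup>2 /
     (qpoch (x ^ 3) (x ^ 6) n * qpoch (x ^ 9) (x ^ 6) n * qpoch (x\<^sup>2) (x ^ 6) n * qpoch (x ^ 8) (x ^ 6) n))
     \<longlonglongrightarrow> q_product (x ^ 6)"
    unfolding q_product_sixth_power[OF x]
    by (intro tendsto_intros qpoch_LIMSEQ x6) (use pos[of 2] pos[of 3] pos[of 8] pos[of 9] in simp)
  ultimately have "(\<lambda>n. \<Prod>j<n. prod_factor x j) \<longlonglongrightarrow> q_product (x ^ 6)"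
    by simp
  then have "(\<lambda>n. ln (\<Prod>j<n. prod_factor x j)) \<longlonglongrightarrow> ln (q_product (x ^ 6))"
    using qp by (intro tendsto_ln) auto
  moreover have "ln (\<Prod>j<n. prod_factor x j) = (\<Sum>j<n. ln (prod_factor x j))" for n
  proof (rule ln_prod)
    show "prod_factor x j \<noteq> 0" for j
      using prod_factor_ge_1[OF x, of j] by linarith
  qed simp
  ultimately show "(\<lambda>j. ln (prod_factor x j)) sums ln (q_product (x ^ 6))"
    by (simp add: sums_def)
qed

section \<open>The limit product and the Gamma function\<close>

definition limit_factor :: "nat \<Rightarrow> real" where
  "limit_factor j = (1 + real j)\<^sup>2 * (5/6 + real j)\<^sup>2 /
     ((1/2 + real j) * (3/2 + real j) * (1/3 + real j) * (4/3 + real j))"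

lemma prod_factor_tendsto: "((\<lambda>x. prod_factor x j) \<longlongrightarrow> limit_factor j) (at_left 1)"
proof (rule Lim_transform_eventually)
  define u where "u m x = (1 - x ^ m) / (1 - x)" for m and x :: real
  have u: "(u m \<longlongrightarrow> real m) (at_left 1)" for m
    unfolding u_def by (rule power_quotient_tendsto)
  have "((\<lambda>x. (u (6 * j + 6) x)\<^sup>2 * (u (6 * j + 5) x)\<^sup>2 /
     (u (6 * j + 3) x * u (6 * j + 9) x * u (6 * j + 2) x * u (6 * j + 8) x)) \<longlongrightarrow>
     (real (6 * j + 6))\<^sup>2 * (real (6 * j + 5))\<^sup>2 /
     (real (6 * j + 3) * real (6 * j + 9) * real (6 * j + 2) * real (6 * j + 8))) (at_left 1)"
    by (intro tendsto_intros u) (simp del: of_nat_add of_nat_mult)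
  also have "(real (6 * j + 6))\<^sup>2 * (real (6 * j + 5))\<^sup>2 /
     (real (6 * j + 3) * real (6 * j + 9) * real (6 * j + 2) * real (6 * j + 8)) = limit_factor j"
  proof -
    have "real (6 * j + 6) = 6 * (1 + real j)" "real (6 * j + 5) = 6 * (5/6 + real j)"
      "real (6 * j + 3) = 6 * (1/2 + real j)" "real (6 * j + 9) = 6 * (3/2 + real j)"
      "real (6 * j + 2) = 6 * (1/3 + real j)" "real (6 * j + 8) = 6 * (4/3 + real j)"
      by simp_all
    moreover have "(6 * a)\<^sup>2 * (6 * b)\<^sup>2 / ((6 * c) * (6 * d) * (6 * e) * (6 * f)) =
        a\<^sup>2 * b\<^sup>2 / (c * d * e * f)" for a b c d e f :: real
      by (simp add: power2_eq_square)
    ultimately show ?thesis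
      by (simp only: limit_factor_def)
  qed
  finally show "((\<lambda>x. (u (6 * j + 6) x)\<^sup>2 * (u (6 * j + 5) x)\<^sup>2 /
     (u (6 * j + 3) x * u (6 * j + 9) x * u (6 * j + 2) x * u (6 * j + 8) x)) \<longlongrightarrow> limit_factor j) (at_left 1)" .
  have "\<forall>\<^sub>F x in at_left 1. x \<in> {0<..<1::real}"
    by (rule eventually_at_left_real) simp
  then show "\<forall>\<^sub>F x in at_left 1. (u (6 * j + 6) x)\<^sup>2 * (u (6 * j + 5) x)\<^sup>2 /
     (u (6 * j + 3) x * u (6 * j + 9) x * u (6 * j + 2) x * u (6 * j + 8) x) = prod_factor x j"
  proof eventually_elim
    case (elim x)
    then have x: "0 < x" "x < 1" by auto
    then show ?case
      unfolding prod_factor_eq[OF x] u_def by (simp add: power2_eq_square)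
  qed
qed

text \<open>The partial products are quotients of \<open>Gamma_series'\<close> terms, four above and
  four below. The powers of n cancel because 1/2 + 3/2 + 1/3 + 4/3 = 2 (1 + 5/6).\<close>

lemma prod_limit_factor_tendsto: "(\<lambda>n. \<Prod>j<n. limit_factor j) \<longlonglongrightarrow> limit_product"
proof (rule Lim_transform_eventually)
  have "(\<lambda>n. Gamma_series' (1/2) n * Gamma_series' (3/2) n * Gamma_series' (1/3) n * Gamma_series' (4/3) n /
      ((Gamma_series' 1 n)\<^sup>2 * (Gamma_series' (5/6) n)\<^sup>2)) \<longlonglongrightarrow>
      Gamma (1/2) * Gamma (3/2) * Gamma (1/3) * Gamma (4/3) / ((Gamma 1)\<^sup>2 * (Gamma (5/6 :: real))\<^sup>2)"
    by (intro tendsto_intros Gamma_series'_LIMSEQ) (auto simp: Gamma_eq_zero_iff)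
  also have "Gamma (1/2) * Gamma (3/2) * Gamma (1/3) * Gamma (4/3) / ((Gamma 1)\<^sup>2 * (Gamma (5/6 :: real))\<^sup>2)
      = limit_product"
  proof -
    have "(1/2 :: real) \<notin> \<int>\<^sub>\<le>\<^sub>0" "(1/3 :: real) \<notin> \<int>\<^sub>\<le>\<^sub>0"
      by (auto dest: nonpos_Ints_nonpos)
    then have Gamma_values: "Gamma (3/2 :: real) = 1/2 * sqrt pi" "Gamma (4/3 :: real) = 1/3 * Gamma (1/3)"
      using Gamma_plus1[of "1/2 :: real"] Gamma_plus1[of "1/3 :: real"] by (auto simp: Gamma_one_half_real)
    show ?thesis
      unfolding limit_product_def Gamma_values Gamma_one_half_real by (simp add: power2_eq_square)
  qed
  finally show "(\<lambda>n. Gamma_series' (1/2) n * Gamma_series' (3/2) n * Gamma_series' (1/3) n * Gamma_series' (4/3) n /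
      ((Gamma_series' 1 n)\<^sup>2 * (Gamma_series' (5/6 :: real) n)\<^sup>2)) \<longlonglongrightarrow> limit_product" .
  have prod: "(\<Prod>j<n. limit_factor j) = (pochhammer 1 n)\<^sup>2 * (pochhammer (5/6) n)\<^sup>2 /
     (pochhammer (1/2) n * pochhammer (3/2) n * pochhammer (1/3) n * pochhammer (4/3) n)" for n
    by (induction n) (simp_all add: limit_factor_def pochhammer_Suc power_mult_distrib mult_ac)
  show "\<forall>\<^sub>F n in sequentially.
      Gamma_series' (1/2) n * Gamma_series' (3/2) n * Gamma_series' (1/3) n * Gamma_series' (4/3) n /
      ((Gamma_series' 1 n)\<^sup>2 * (Gamma_series' (5/6) n)\<^sup>2) = (\<Prod>j<n. limit_factor j)"
  proof (rule always_eventually, rule allI)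
    fix n :: nat
    \<comment> \<open>L cancels whatever its value, so n = 0, where \<open>ln\<close> takes a
      default value, is covered too.\<close>
    define L where "L = ln (real n)"
    have "exp (1/2 * L) * exp (3/2 * L) * exp (1/3 * L) * exp (4/3 * L) = (exp (1 * L))\<^sup>2 * (exp (5/6 * L))\<^sup>2"
      unfolding power2_eq_square mult_exp_exp by simp
    then have ex: "exp (1/2 * L) * exp (3/2 * L) * exp (1/3 * L) * exp (4/3 * L) /
        ((exp (1 * L))\<^sup>2 * (exp (5/6 * L))\<^sup>2) = 1"
      by simp
    have "f * a / p1 * (f * b / p2) * (f * c / p3) * (f * d / p4) / ((f * g / p5)\<^sup>2 * (f * h / p6)\<^sup>2) =
      (a * b * c * d / (g\<^sup>2 * h\<^sup>2)) * (p5\<^sup>2 * p6\<^sup>2 / (p1 * p2 * p3 * p4))"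
      if "f \<noteq> 0" for a b c d f g h p1 p2 p3 p4 p5 p6 :: real
      using that by (simp add: power2_eq_square) (simp add: mult_ac)
    note cancel = this[OF fact_nonzero]
    show
      "Gamma_series' (1/2) n * Gamma_series' (3/2) n * Gamma_series' (1/3) n * Gamma_series' (4/3) n /
      ((Gamma_series' 1 n)\<^sup>2 * (Gamma_series' (5/6) n)\<^sup>2) = (\<Prod>j<n. limit_factor j)"
      unfolding prod Gamma_series'_def of_real_eq_id id_apply L_def[symmetric] cancel ex by simp
  qed
qed

text \<open>Logarithms turn the product into a series dominated by 18 / (j+1)^2, to which Tannery's
  theorem applies. The limit series is then identified through its exponentiated partial
  sums.\<close>

lemma q_product_tendsto: "(q_product \<longlongrightarrow> limit_product) (at_left 1)"
proof (rule at_left_1_sixth_power)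
  have pos: "limit_factor j > 0" for j
    by (simp add: limit_factor_def add_pos_nonneg)
  have ev: "\<forall>\<^sub>F x in at_left 1. x \<in> {0<..<1::real}"
    by (rule eventually_at_left_real) simp
  then have bound: "\<forall>\<^sub>F (j, x) in sequentially \<times>\<^sub>F at_left 1.
      norm (ln (prod_factor x j)) \<le> 18 * (1 / (real (Suc j))\<^sup>2)"
    unfolding eventually_prod_filter
    using ln_prod_factor_bound by (intro exI[of _ "\<lambda>_. True"] exI[of _ "\<lambda>q. q \<in> {0<..<1}"]) auto
  have "summable (\<lambda>j. 18 * (1 / (real (Suc j))\<^sup>2))"
    using inverse_power_summable[of 2, where 'a = real]
    by (intro summable_mult summable_Suc_iff[of "\<lambda>j. 1 / (real j)\<^sup>2", THEN iffD2])
      (simp add: inverse_eq_divide)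
  from tannerys_theorem[OF tendsto_ln[OF prod_factor_tendsto] bound this]
  have T: "summable (\<lambda>j. norm (ln (limit_factor j)))"
    "((\<lambda>x. \<Sum>j. ln (prod_factor x j)) \<longlongrightarrow> (\<Sum>j. ln (limit_factor j))) (at_left 1)"
    using pos by (auto simp: less_imp_neq[symmetric])
  have "(\<lambda>n. exp (\<Sum>j<n. ln (limit_factor j))) \<longlonglongrightarrow> exp (\<Sum>j. ln (limit_factor j))"
    by (intro tendsto_exp summable_LIMSEQ summable_norm_cancel[OF T(1)])
  moreover have "exp (\<Sum>j<n. ln (limit_factor j)) = (\<Prod>j<n. limit_factor j)" for n
    by (simp add: exp_sum pos)
  ultimately have "exp (\<Sum>j. ln (limit_factor j)) = limit_product"
    using prod_limit_factor_tendsto LIMSEQ_unique by simp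
  then have "((\<lambda>x. exp (\<Sum>j. ln (prod_factor x j))) \<longlongrightarrow> limit_product) (at_left 1)"
    using tendsto_exp[OF T(2)] by simp
  moreover have "\<forall>\<^sub>F x in at_left 1. exp (\<Sum>j. ln (prod_factor x j)) = q_product (x ^ 6)"
    using ev
  proof eventually_elim
    case (elim x)
    then have x: "0 < x" "x < 1" by auto
    show ?case
      using ln_prod_factor_sums(2)[OF x] by (simp flip: sums_unique[OF ln_prod_factor_sums(1)[OF x]])
  qed
  ultimately show "((\<lambda>x. q_product (x ^ 6)) \<longlongrightarrow> limit_product) (at_left 1)"
    by (rule Lim_transform_eventually)
qed

section \<open>Comparison of the two limits\<close>

theorem mainTheorem7:
  shows "(\<forall>q::real. 0 < q \<and> q < 1 \<longrightarrow> q_summand q sums q_product q) \<and>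
    (q_product \<longlongrightarrow> limit_product) (at_left 1) \<and>
    ((\<lambda>q. \<Sum>n. q_summand q n) \<longlongrightarrow> (\<Sum>n. limit_summand n)) (at_left 1) \<and>
    limit_summand sums limit_product"
proof (intro conjI allI impI)
  \<comment> \<open>The sum in (ii) is found by computing the limit of \<open>q_product\<close>
    twice: through the series, by (i), and directly from the product.\<close>
  have "\<forall>\<^sub>F q in at_left 1. q \<in> {0<..<1::real}"
    by (rule eventually_at_left_real) simp
  then have "\<forall>\<^sub>F q in at_left 1. (\<Sum>n. q_summand q n) = q_product q"
    by eventually_elim (use q_summand_sums in \<open>auto simp: sums_unique[symmetric]\<close>)
  with suminf_q_summand_tendsto have "(q_product \<longlongrightarrow> (\<Sum>n. limit_summand n)) (at_left 1)"
    by (rule Lim_transform_eventually)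
  then have "(\<Sum>n. limit_summand n) = limit_product"
    using q_product_tendsto by (intro tendsto_unique[of "at_left (1::real)"]) auto
  then show "limit_summand sums limit_product"
    using summable_limit_summand by (simp add: sums_iff)
qed (use q_summand_sums q_product_tendsto suminf_q_summand_tendsto in auto)

end
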